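(* Let $t\in\{1,2,3\}$ and let $G$ be a simple connected $t$-tough graph of order $n$ and size $m$. If the signless Laplacian spectral radius $q(G)$ satisfies $$q(G) \geq \frac{n^2 + 10t^2 - 4tn + 2t - n}{n-1} + n - 2,$$ then $G$ is pancyclic or bipartite, provided that 1) $t=1$ and $n\ge 7$; or 2) $t=2$ and $n\ge 16$; or 3) $t=3$ and $n\ge 28$.
   Context: All graphs are finite, simple and undirected. For a graph $G$ with vertices $v_1,\dots,v_n$, let $A(G)$ be its adjacency matrix and $D(G)=\mathrm{diag}(d(v_1),\dots,d(v_n))$ its diagonal degree matrix; the signless Laplacian is $Q(G)=D(G)+A(G)$ and $q(G)$ denotes its largest eigenvalue. $c(G)$ is the number of connected components. A vertex cutset of a connected graph $G$ is a set $S\subseteq V(G)$ with $c(G-S)\ge 2$, where $G-S$ is the subgraph induced by $V(G)\setminus S$. For a real number $t$, $G$ is $t$-tough if $t\cdot c(G-S)\le |S|$ for every vertex cutset $S$ (complete graphs are $t$-tough for every $t$). A graph of order $n$ is pancyclic if it contains a cycle of every length $\ell$ with $3\le\ell\le n$. *)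

theory Defs
  imports
    "Graph_Theory.Digraph_Component"
    "Jordan_Normal_Form.Spectral_Radius"
begin

text \<open>
  A finite simple undirected graph is a \<^locale>\<open>pair_graph\<close>: a finite vertex set with a
  symmetric, irreflexive relation \<^const>\<open>parcs\<close>, so that each edge \<open>uv\<close> appears as
  the two arcs \<open>(u,v)\<close> and \<open>(v,u)\<close>. The constant \<^const>\<open>with_proj\<close> embeds such a graph
  into general digraphs.
\<close>

definition edges :: "'a pair_pre_digraph \<Rightarrow> 'a set set" where
  "edges G = (\<lambda>(u, v). {u, v}) ` parcs G"

text \<open>
  The matrices of \<open>G\<close> with respect to an enumeration \<open>vs = [v\<^sub>1, \<dots>, v\<^sub>n]\<close> of its vertices.
  In a symmetric digraph the out-degree of a vertex is its number of neighbours.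
\<close>

definition adjacency_mat :: "'a pair_pre_digraph \<Rightarrow> 'a list \<Rightarrow> real mat" where
  "adjacency_mat G vs = mat (length vs) (length vs)
     (\<lambda>(i, j). if (vs ! i, vs ! j) \<in> parcs G then 1 else 0)"

definition degree_mat :: "'a pair_pre_digraph \<Rightarrow> 'a list \<Rightarrow> real mat" where
  "degree_mat G vs = mat (length vs) (length vs)
     (\<lambda>(i, j). if i = j then real (out_degree (with_proj G) (vs ! i)) else 0)"

definition signless_laplacian :: "'a pair_pre_digraph \<Rightarrow> 'a list \<Rightarrow> real mat" where
  "signless_laplacian G vs = degree_mat G vs + adjacency_mat G vs"

text \<open>
  The signless Laplacian is a real symmetric matrix, so all its eigenvalues are real and
  its spectrum as a real matrix is finite and (for a nonempty graph) nonempty.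
\<close>

definition largest_eigenvalue :: "real mat \<Rightarrow> real" where
  "largest_eigenvalue A = Max (spectrum A)"

text \<open>
  In a symmetric digraph the strongly connected components are the connected components.
  The null graph has none.
\<close>

definition num_components :: "('a, 'b) pre_digraph \<Rightarrow> nat" where
  "num_components H = card (pre_digraph.sccs H)"

definition delete_verts :: "'a pair_pre_digraph \<Rightarrow> 'a set \<Rightarrow> ('a, 'a \<times> 'a) pre_digraph" where
  "delete_verts G S = with_proj G \<restriction> (pverts G - S)"

definition vertex_cutset :: "'a pair_pre_digraph \<Rightarrow> 'a set \<Rightarrow> bool" where
  "vertex_cutset G S \<longleftrightarrow> S \<subseteq> pverts G \<and> num_components (delete_verts G S) \<ge> 2"

definition tough :: "real \<Rightarrow> 'a pair_pre_digraph \<Rightarrow> bool" where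
  "tough t G \<longleftrightarrow>
     (\<forall>S. vertex_cutset G S \<longrightarrow> t * real (num_components (delete_verts G S)) \<le> real (card S))"

text \<open>
  The library's directed cycles of length at least 3 are exactly the cycles of the
  undirected graph; the back-and-forth walks \<open>u, v, u\<close> have length 2.
\<close>

definition pancyclic :: "'a pair_pre_digraph \<Rightarrow> bool" where
  "pancyclic G \<longleftrightarrow>
     (\<forall>l. 3 \<le> l \<and> l \<le> card (pverts G) \<longrightarrow>
        (\<exists>p. pre_digraph.cycle (with_proj G) p \<and> length p = l))"

definition bipartite :: "'a pair_pre_digraph \<Rightarrow> bool" where
  "bipartite G \<longleftrightarrow>
     (\<exists>X Y. X \<union> Y = pverts G \<and> X \<inter> Y = {} \<and>
        (\<forall>(u, v) \<in> parcs G. u \<in> X \<and> v \<in> Y \<or> u \<in> Y \<and> v \<in> X))"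

end

theory Submission
  imports Defs
begin

text \<open>
  The bound \<open>q(G) \<le> 2m/(n-1) + n - 2\<close> turns the spectral hypothesis into the edge bound
  \<open>2m \<ge> (n-2t)(n-2t-1) + 6t\<^sup>2 > n\<^sup>2/2\<close>. By Bondy's argument a Hamiltonian graph with so many edges is
  pancyclic, so it remains to find a Hamiltonian cycle; the bipartite case never occurs.

  Suppose there is none and add edges as long as this remains true. Then nonadjacent vertices have
  degree sum at most \<open>n-1\<close>. Take a nonadjacent pair \<open>u, v\<close> with \<open>i = d(u) \<le> d(v) = j\<close>, maximising first
  \<open>i + j\<close> and then \<open>j\<close>. The \<open>a = n-1-j\<close> non-neighbours of \<open>v\<close> have degree at most \<open>i\<close>, and the set \<open>S\<close> of
  vertices of degree above \<open>j\<close> is contained in the neighbourhood of \<open>u\<close>. The edge bound leaves so little slack that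
  \<open>S\<close> consists of universal vertices and that, in \<open>G - S\<close>, all degrees are at most \<open>t \<le> 3\<close>, except
  possibly in one component that is a clique. Toughness bounds the number of components, and hence \<open>G - S\<close>
  is covered by at most \<open>|S|\<close> disjoint paths. Joining these through \<open>S\<close> gives a Hamiltonian cycle.
\<close>

section \<open>Hamiltonian cycles and saturated graphs\<close>

locale sgraph =
  fixes V :: "'a set" and E :: "'a rel"
  assumes finite_V: "finite V" and E_V: "E \<subseteq> V \<times> V" and sym_E: "sym E" and irrefl_E: "irrefl E"

definition deg :: "'a rel \<Rightarrow> 'a \<Rightarrow> nat" where
  "deg E x = card (E `` {x})"

abbreviation walk :: "'a rel \<Rightarrow> 'a list \<Rightarrow> bool" where
  "walk E \<equiv> successively (\<lambda>x y. (x, y) \<in> E)"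

text \<open>Indices modulo the length make the notion invariant under rotation. A list of length 2
  running along one edge and back also qualifies; cycles are read off only for lengths at least
  3.\<close>

definition cyclic_list :: "'a rel \<Rightarrow> 'a list \<Rightarrow> bool" where
  "cyclic_list E c \<longleftrightarrow> c \<noteq> [] \<and> distinct c \<and> (\<forall>i < length c. (c ! i, c ! (Suc i mod length c)) \<in> E)"

definition hamiltonian :: "'a set \<Rightarrow> 'a rel \<Rightarrow> bool" where
  "hamiltonian V E \<longleftrightarrow> (\<exists>c. cyclic_list E c \<and> set c = V)"

lemma cyclic_list_iff:
  "cyclic_list E c \<longleftrightarrow> c \<noteq> [] \<and> distinct c \<and> walk E c \<and> (last c, hd c) \<in> E"
proof (cases "c = []")
  case False
  have "(\<forall>i < length c. (c ! i, c ! (Suc i mod length c)) \<in> E) \<longleftrightarrow>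
    (\<forall>i. Suc i < length c \<longrightarrow> (c ! i, c ! Suc i) \<in> E) \<and> (c ! (length c - 1), c ! 0) \<in> E" (is "?l \<longleftrightarrow> ?r")
  proof
    assume l: ?l
    show ?r
    proof (intro conjI allI impI)
      fix i assume "Suc i < length c"
      with l[rule_format, of i] show "(c ! i, c ! Suc i) \<in> E" by simp
    next
      from l[rule_format, of "length c - 1"] False show "(c ! (length c - 1), c ! 0) \<in> E" by simp
    qed
  next
    assume r: ?r
    show ?l
    proof (intro allI impI)
      fix i assume i: "i < length c"
      show "(c ! i, c ! (Suc i mod length c)) \<in> E"
      proof (cases "Suc i = length c")
        case True
        hence "i = length c - 1" by simp
        with r True show ?thesis by simp
      next
        case F: False
        with i r show ?thesis by simp
      qed
    qed
  qed
  with False show ?thesis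
    by (simp add: cyclic_list_def successively_conv_nth last_conv_nth hd_conv_nth)
qed (simp add: cyclic_list_def)

lemma cyclic_list_rotate:
  assumes "cyclic_list E c"
  shows "cyclic_list E (rotate k c)"
  unfolding cyclic_list_def
proof (intro conjI allI impI)
  fix i assume i: "i < length (rotate k c)"
  let ?n = "length c"
  have n: "0 < ?n" using i by (cases c) auto
  have "((k + i) mod ?n) < ?n" using n by simp
  with assms have "(c ! ((k + i) mod ?n), c ! (Suc ((k + i) mod ?n) mod ?n)) \<in> E"
    unfolding cyclic_list_def by blast
  moreover have "Suc ((k + i) mod ?n) mod ?n = (k + Suc i mod ?n) mod ?n"
    by (simp add: mod_simps)
  ultimately show "(rotate k c ! i, rotate k c ! (Suc i mod length (rotate k c))) \<in> E"
    using i n by (simp add: nth_rotate)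
qed (use assms in \<open>auto simp: cyclic_list_def\<close>)

lemma walk_rev: "sym E \<Longrightarrow> walk E (rev p) \<longleftrightarrow> walk E p"
  unfolding successively_rev by (rule successively_cong) (auto dest: symD)

context sgraph
begin

lemma E_sym: "(x, y) \<in> E \<Longrightarrow> (y, x) \<in> E"
  using sym_E by (auto dest: symD)

lemma no_loop: "(x, x) \<notin> E"
  using irrefl_E by (auto simp: irrefl_def)

lemma nbrs_subset: "E `` {x} \<subseteq> V"
  using E_V by auto

lemma finite_nbrs [simp]: "finite (E `` {x})"
  using finite_subset[OF nbrs_subset finite_V] .

lemma nbrs_subset': "E `` {x} \<subseteq> V - {x}"
  using nbrs_subset no_loop by auto

lemma deg_le: "x \<in> V \<Longrightarrow> deg E x \<le> card V - 1"
  unfolding deg_def using card_mono[OF _ nbrs_subset'[of x]] finite_V by simp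

lemma deg_add_nonnbrs: "x \<in> V \<Longrightarrow> deg E x + card (V - {x} - E `` {x}) = card V - 1"
  unfolding deg_def
  using card_Diff_subset[OF finite_nbrs[of x] nbrs_subset'[of x]] card_mono[OF _ nbrs_subset'[of x]] finite_V
  by simp

text \<open>Ore's crossing argument: a closing chord from the first vertex to position \<open>l + 1\<close> and one from
  the last vertex to position \<open>l\<close> would yield a Hamiltonian cycle.\<close>

lemma deg_ends_hamiltonian_path:
  assumes p: "distinct p" "set p = V" "walk E p" "p \<noteq> []" and nh: "\<not> hamiltonian V E"
  shows "deg E (hd p) + deg E (last p) \<le> card V - 1"
proof -
  let ?n = "length p"
  have n: "?n = card V" using p distinct_card by metis
  define I where "I = {l. Suc l < ?n \<and> (hd p, p ! Suc l) \<in> E}"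
  define J where "J = {l. Suc l < ?n \<and> (last p, p ! l) \<in> E}"
  have hd: "hd p = p ! 0" and last: "last p = p ! (?n - 1)"
    using p by (auto simp: hd_conv_nth last_conv_nth)
  have IJ: "I \<subseteq> {..<?n - 1}" "J \<subseteq> {..<?n - 1}"
    by (auto simp: I_def J_def)
  have fin: "finite I" "finite J" using IJ finite_subset by blast+
  have "E `` {hd p} \<subseteq> (\<lambda>l. p ! Suc l) ` I"
  proof
    fix y assume y: "y \<in> E `` {hd p}"
    then obtain m where m: "m < ?n" "y = p ! m"
      using nbrs_subset p(2) by (metis in_set_conv_nth subsetD)
    moreover have "m \<noteq> 0" using y m no_loop hd by (metis Image_singleton_iff)
    ultimately show "y \<in> (\<lambda>l. p ! Suc l) ` I"
      using y by (auto simp: I_def intro!: image_eqI[of _ _ "m - 1"])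
  qed
  hence dI: "deg E (hd p) \<le> card I"
    unfolding deg_def using fin by (meson card_image_le card_mono finite_imageI le_trans)
  have "E `` {last p} \<subseteq> (\<lambda>l. p ! l) ` J"
  proof
    fix y assume y: "y \<in> E `` {last p}"
    then obtain m where m: "m < ?n" "y = p ! m"
      using nbrs_subset p(2) by (metis in_set_conv_nth subsetD)
    moreover have "m \<noteq> ?n - 1" using y m no_loop last by (metis Image_singleton_iff)
    ultimately show "y \<in> (\<lambda>l. p ! l) ` J"
      using y by (auto simp: J_def)
  qed
  hence dJ: "deg E (last p) \<le> card J"
    unfolding deg_def using fin by (meson card_image_le card_mono finite_imageI le_trans)
  have "I \<inter> J = {}"
  proof (rule ccontr)
    assume "I \<inter> J \<noteq> {}"
    then obtain l where l: "Suc l < ?n" "(hd p, p ! Suc l) \<in> E" "(last p, p ! l) \<in> E"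
      by (auto simp: I_def J_def)
    define a b where "a = take (Suc l) p" and "b = drop (Suc l) p"
    have ab: "p = a @ b" by (simp add: a_def b_def)
    have ne: "a \<noteq> []" "b \<noteq> []" using l by (auto simp: a_def b_def)
    have la: "last a = p ! l" using l by (simp add: a_def take_Suc_conv_app_nth)
    have hb: "hd b = p ! Suc l" using l by (simp add: b_def hd_drop_conv_nth)
    have "cyclic_list E (a @ rev b)"
      unfolding cyclic_list_iff
    proof (intro conjI)
      show "walk E (a @ rev b)"
        using p(3) ne l la E_sym unfolding ab successively_append_iff walk_rev[OF sym_E]
        by (auto simp: hd_rev ab)
      show "distinct (a @ rev b)" using p(1) ab by simp
      show "(last (a @ rev b), hd (a @ rev b)) \<in> E"
        using ne l hb E_sym by (simp add: last_rev ab)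
    qed (use ne in simp)
    moreover have "set (a @ rev b) = V" using p(2) ab by simp
    ultimately show False using nh unfolding hamiltonian_def by blast
  qed
  hence "card I + card J = card (I \<union> J)" using fin by (simp add: card_Un_disjoint)
  also have "\<dots> \<le> card {..<?n - 1}" using IJ by (intro card_mono) auto
  finally show ?thesis using dI dJ n by simp
qed

text \<open>A Hamiltonian cycle of the enlarged graph must use the new edge. Rotated so that this
  edge closes it, the cycle is a Hamiltonian path of the old graph between \<open>u\<close> and
  \<open>v\<close>, to which the crossing argument applies.\<close>

lemma deg_sum_if_edge_hamiltonian:
  assumes V3: "3 \<le> card V" and nh: "\<not> hamiltonian V E"
    and h: "hamiltonian V (E \<union> {(u, v), (v, u)})"
  shows "deg E u + deg E v \<le> card V - 1"
proof -
  let ?E = "E \<union> {(u, v), (v, u)}"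
  from h obtain c where c: "cyclic_list ?E c" "set c = V" unfolding hamiltonian_def by blast
  let ?n = "length c"
  have n: "?n = card V" using c distinct_card unfolding cyclic_list_def by metis
  have "\<not> cyclic_list E c" using nh c unfolding hamiltonian_def by blast
  then obtain i where i: "i < ?n" "(c ! i, c ! (Suc i mod ?n)) \<notin> E"
    using c unfolding cyclic_list_def by blast
  hence uv: "(c ! i, c ! (Suc i mod ?n)) \<in> {(u, v), (v, u)}"
    using c unfolding cyclic_list_def by blast
  define p where "p = rotate (Suc i) c"
  have p: "cyclic_list ?E p" "set p = V" "length p = ?n"
    using c cyclic_list_rotate[of ?E c "Suc i"] unfolding p_def by (auto simp del: rotate_Suc)
  hence p': "distinct p" "walk ?E p" "p \<noteq> []" unfolding cyclic_list_iff by auto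
  have hd: "hd p = c ! (Suc i mod ?n)"
    using p' i by (simp add: p_def hd_rotate_conv_nth del: rotate_Suc)
  have "last p = p ! (?n - 1)" using p' p(3) by (simp add: last_conv_nth)
  also have "\<dots> = c ! ((Suc i + (?n - 1)) mod ?n)"
    unfolding p_def using i by (intro nth_rotate) auto
  also have "Suc i + (?n - 1) = i + ?n" using i by simp
  finally have last: "last p = c ! i" using i by simp
  have ends: "{hd p, last p} = {u, v}" "hd p \<in> {u, v}" using uv hd last by auto
  have "walk E p"
    unfolding successively_conv_nth
  proof (intro allI impI)
    fix j assume j: "Suc j < length p"
    from successively_nth[OF p'(2) j] have e: "(p ! j, p ! Suc j) \<in> ?E" .
    \<comment> \<open>Only the two end positions carry \<open>u\<close> or \<open>v\<close>. They
      are not consecutive since there are at least three vertices, so the path never steps along the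
      new edge.\<close>
    have idx: "m = 0 \<or> m = ?n - 1" if "p ! m \<in> {u, v}" "m < ?n" for m
    proof -
      have "p ! m = p ! 0 \<or> p ! m = p ! (?n - 1)"
        using that ends p p' by (auto simp: hd_conv_nth last_conv_nth)
      moreover have "0 < ?n" "?n - 1 < ?n" using that(2) by linarith+
      ultimately show ?thesis using that(2) p(3) nth_eq_iff_index_eq[OF p'(1)] by metis
    qed
    show "(p ! j, p ! Suc j) \<in> E"
    proof (rule ccontr)
      assume "(p ! j, p ! Suc j) \<notin> E"
      with e have "p ! j \<in> {u, v}" "p ! Suc j \<in> {u, v}" by auto
      with idx[of j] idx[of "Suc j"] j p(3) n V3 show False by auto
    qed
  qed
  from deg_ends_hamiltonian_path[OF p'(1) p(2) this p'(3) nh]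
  show ?thesis using uv hd last by auto
qed

text \<open>Among the finitely many non-Hamiltonian graphs on \<open>V\<close>, take a maximal one
  above \<open>E\<close>: each further edge creates a Hamiltonian cycle, and the previous lemma
  bounds the degree sum of its ends.\<close>

lemma saturated_supergraph:
  assumes V3: "3 \<le> card V" and nh: "\<not> hamiltonian V E"
  obtains E' where "E \<subseteq> E'" "sgraph V E'" "\<not> hamiltonian V E'"
    "\<And>u v. u \<in> V \<Longrightarrow> v \<in> V \<Longrightarrow> u \<noteq> v \<Longrightarrow> (u, v) \<notin> E' \<Longrightarrow> deg E' u + deg E' v \<le> card V - 1"
proof -
  define A where "A = {F. sgraph V F \<and> \<not> hamiltonian V F}"
  have "A \<subseteq> Pow (V \<times> V)" unfolding A_def sgraph_def by auto
  hence "finite A" using finite_V by (meson finite_Pow_iff finite_SigmaI finite_subset)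
  moreover have "E \<in> A" using nh sgraph_axioms unfolding A_def by simp
  ultimately obtain F where F: "F \<in> A" "E \<subseteq> F" "\<And>B. B \<in> A \<Longrightarrow> F \<subseteq> B \<Longrightarrow> F = B"
    by (metis finite_has_maximal2)
  interpret F: sgraph V F using F(1) unfolding A_def by simp
  show thesis
  proof (rule that[of F])
    fix u v assume uv: "u \<in> V" "v \<in> V" "u \<noteq> v" "(u, v) \<notin> F"
    let ?F = "F \<union> {(u, v), (v, u)}"
    have "sgraph V ?F"
      using F.finite_V F.E_V F.sym_E F.irrefl_E uv
      by unfold_locales (auto simp: sym_def irrefl_def)
    moreover have "?F \<notin> A" using F(3)[of ?F] uv by blast
    ultimately have "hamiltonian V ?F" unfolding A_def by simp
    thus "deg F u + deg F v \<le> card V - 1"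
      using F.deg_sum_if_edge_hamiltonian[OF V3] F(1) unfolding A_def by simp
  qed (use F in \<open>auto simp: A_def\<close>)
qed

end

section \<open>Path covers\<close>

text \<open>Each path is followed by one vertex of \<open>ss\<close>, which is adjacent to
  everything; the vertices of \<open>ss\<close> left over are appended at the end. Since the result
  ends in \<open>ss\<close>, it can later be closed to a cycle.\<close>

lemma join_paths:
  assumes "\<forall>P \<in> set Ps. P \<noteq> [] \<and> walk E P" "length Ps \<le> length ss" "distinct (concat Ps @ ss)"
    "\<forall>s \<in> set ss. \<forall>y \<in> set (concat Ps @ ss) - {s}. (s, y) \<in> E \<and> (y, s) \<in> E"
  shows "\<exists>c. walk E c \<and> distinct c \<and> set c = set (concat Ps @ ss) \<and> (c \<noteq> [] \<longrightarrow> last c \<in> set ss)"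
  using assms
proof (induction Ps arbitrary: ss)
  case Nil
  have "walk E ss"
    unfolding successively_conv_nth
  proof (intro allI impI)
    fix i assume i: "Suc i < length ss"
    hence "ss ! i \<in> set ss" "ss ! Suc i \<in> set ss - {ss ! i}"
      using Nil.prems(3) by (simp_all add: nth_eq_iff_index_eq)
    thus "(ss ! i, ss ! Suc i) \<in> E" using Nil.prems(4) by simp
  qed
  thus ?case using Nil.prems(3) by (intro exI[of _ ss]) simp
next
  case (Cons P Ps)
  then obtain s ss' where ss: "ss = s # ss'" by (cases ss) auto
  have d: "distinct P" "distinct (concat Ps @ ss')" "s \<notin> set (concat Ps @ ss')" "s \<notin> set P"
    "set P \<inter> set (concat Ps @ ss') = {}"
    using Cons.prems(3) unfolding ss by (simp_all add: Int_Un_distrib)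
  have adj: "(s', y) \<in> E \<and> (y, s') \<in> E"
    if "s' \<in> set ss" "y \<in> set P \<union> set (concat Ps @ ss)" "y \<noteq> s'" for s' y
    using Cons.prems(4) that by simp
  have "\<exists>c. walk E c \<and> distinct c \<and> set c = set (concat Ps @ ss') \<and> (c \<noteq> [] \<longrightarrow> last c \<in> set ss')"
  proof (rule Cons.IH)
    show "\<forall>P \<in> set Ps. P \<noteq> [] \<and> walk E P" "length Ps \<le> length ss'"
      using Cons.prems(1,2) ss by simp_all
    show "\<forall>s \<in> set ss'. \<forall>y \<in> set (concat Ps @ ss') - {s}. (s, y) \<in> E \<and> (y, s) \<in> E"
      using adj unfolding ss by simp
  qed (rule d(2))
  then obtain c where c: "walk E c" "distinct c" "set c = set (concat Ps @ ss')" "c \<noteq> [] \<longrightarrow> last c \<in> set ss'"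
    by blast
  have P: "P \<noteq> []" "walk E P" "last P \<in> set P" using Cons.prems(1) by simp_all
  have "last P \<noteq> s" using P d(4) by metis
  hence "(last P, s) \<in> E" using adj[of s "last P"] P(3) ss by simp
  moreover have "(s, hd c) \<in> E" if "c \<noteq> []"
  proof -
    have "hd c \<in> set (concat Ps @ ss')" using c(3) that by (metis hd_in_set)
    moreover from this have "hd c \<noteq> s" using d(3) by metis
    ultimately show ?thesis using adj[of s "hd c"] ss by simp
  qed
  ultimately have "walk E (P @ s # c)"
    using P c(1) by (cases "c = []") (simp_all add: successively_append_iff successively_Cons)
  moreover have "distinct (P @ s # c)" using c(2) d unfolding c(3)[symmetric] by simp
  moreover have "set (P @ s # c) = set (concat (P # Ps) @ ss)" using c(3) ss by simp
  moreover have "last (P @ s # c) \<in> set ss" using c(4) ss by simp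
  ultimately show ?case by (intro exI[of _ "P @ s # c"]) simp
qed

definition path_cover :: "'a rel \<Rightarrow> 'a set \<Rightarrow> 'a list set \<Rightarrow> bool" where
  "path_cover E W C \<longleftrightarrow> finite C \<and> (\<forall>P \<in> C. P \<noteq> [] \<and> distinct P \<and> walk E P) \<and>
     (\<forall>P \<in> C. \<forall>Q \<in> C. P \<noteq> Q \<longrightarrow> set P \<inter> set Q = {}) \<and> \<Union> (set ` C) = W"

lemma hamiltonian_if_path_cover:
  assumes fin: "finite V" and V2: "2 \<le> card V" and S: "S \<subseteq> V" "S \<noteq> {}"
    and univ: "\<And>s y. s \<in> S \<Longrightarrow> y \<in> V \<Longrightarrow> y \<noteq> s \<Longrightarrow> (s, y) \<in> E \<and> (y, s) \<in> E"
    and C: "path_cover E (V - S) C" and le: "card C \<le> card S"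
  shows "hamiltonian V E"
proof -
  have C': "finite C" "\<And>P. P \<in> C \<Longrightarrow> P \<noteq> [] \<and> distinct P \<and> walk E P"
    "\<And>P Q. P \<in> C \<Longrightarrow> Q \<in> C \<Longrightarrow> P \<noteq> Q \<Longrightarrow> set P \<inter> set Q = {}" "\<Union> (set ` C) = V - S"
    using C unfolding path_cover_def by simp_all
  obtain Ps where Ps: "set Ps = C" "distinct Ps" using finite_distinct_list[OF C'(1)] by blast
  obtain ss where ss: "set ss = S" "distinct ss"
    using finite_distinct_list[OF finite_subset[OF S(1) fin]] by blast
  have "distinct (concat Ps)"
    by (rule distinct_concat) (simp_all add: Ps C')
  moreover have cP: "set (concat Ps) = V - S" using Ps(1) C'(4) by simp
  ultimately have d: "distinct (concat Ps @ ss)" using ss by (simp add: Diff_Int_distrib2)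
  have cV: "set (concat Ps @ ss) = V" using cP ss(1) S(1) by (simp; blast)
  have "\<exists>c. walk E c \<and> distinct c \<and> set c = set (concat Ps @ ss) \<and> (c \<noteq> [] \<longrightarrow> last c \<in> set ss)"
  proof (rule join_paths)
    show "\<forall>P \<in> set Ps. P \<noteq> [] \<and> walk E P" using Ps(1) C'(2) by simp
    show "length Ps \<le> length ss" using le distinct_card[OF Ps(2)] distinct_card[OF ss(2)] Ps(1) ss(1) by simp
    show "\<forall>s \<in> set ss. \<forall>y \<in> set (concat Ps @ ss) - {s}. (s, y) \<in> E \<and> (y, s) \<in> E"
      unfolding cV ss using univ by simp
  qed (rule d)
  then obtain c where c: "walk E c" "distinct c" "set c = V" "c \<noteq> [] \<longrightarrow> last c \<in> S"
    unfolding cV ss by blast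
  \<comment> \<open>With two vertices the ends of \<open>c\<close> differ, so the universal vertex
    \<open>last c\<close> supplies the closing edge.\<close>
  have len: "2 \<le> length c" using V2 distinct_card[OF c(2)] c(3) by simp
  hence ne: "c \<noteq> []" by auto
  hence mem: "last c \<in> S" "hd c \<in> V" using c(3,4) by auto
  have "last c \<noteq> hd c"
    using len c(2) ne by (simp add: last_conv_nth hd_conv_nth nth_eq_iff_index_eq)
  hence "(last c, hd c) \<in> E" using univ[OF mem] by metis
  hence "cyclic_list E c" unfolding cyclic_list_iff using c(1,2) ne by simp
  thus ?thesis using c(3) unfolding hamiltonian_def by blast
qed

section \<open>Merging paths and minimal path covers\<close>

lemma path_cover_Un:
  assumes "path_cover E A C" "path_cover E B D" "A \<inter> B = {}"
  shows "path_cover E (A \<union> B) (C \<union> D)"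
proof -
  have "set P \<inter> set Q = {}" if "P \<in> C" "Q \<in> D" for P Q
  proof -
    have "set P \<subseteq> A" "set Q \<subseteq> B" using assms that unfolding path_cover_def by auto
    thus ?thesis using assms(3) by blast
  qed
  moreover from this have "set Q \<inter> set P = {}" if "P \<in> C" "Q \<in> D" for P Q
    using that by blast
  ultimately show ?thesis
    using assms(1,2) unfolding path_cover_def by (simp add: ball_Un)
qed

text \<open>Reversal where needed makes the first path end at \<open>x\<close> and the second begin
  at \<open>y\<close>, so the edge joins them into one path replacing both.\<close>

lemma path_cover_merge:
  assumes C: "path_cover E W C" and sym: "sym E" and PQ: "P \<in> C" "Q \<in> C" "P \<noteq> Q"
    and xy: "x \<in> {hd P, last P}" "y \<in> {hd Q, last Q}" "(x, y) \<in> E"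
  shows "\<exists>C'. path_cover E W C' \<and> card C' < card C"
proof -
  define P' where "P' = (if x = last P then P else rev P)"
  define Q' where "Q' = (if y = hd Q then Q else rev Q)"
  have P: "P \<noteq> []" "distinct P" "walk E P" and Q: "Q \<noteq> []" "distinct Q" "walk E Q"
    and disj: "set P \<inter> set Q = {}" and fin: "finite C"
    using C PQ unfolding path_cover_def by auto
  have P': "P' \<noteq> []" "distinct P'" "walk E P'" "set P' = set P" "last P' = x"
    using P xy(1) unfolding P'_def by (auto simp: walk_rev[OF sym] last_rev simp del: successively_rev)
  have Q': "Q' \<noteq> []" "distinct Q'" "walk E Q'" "set Q' = set Q" "hd Q' = y"
    using Q xy(2) unfolding Q'_def by (auto simp: walk_rev[OF sym] hd_rev simp del: successively_rev)
  let ?C = "insert (P' @ Q') (C - {P, Q})"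
  have "path_cover E W ?C"
    unfolding path_cover_def
  proof (intro conjI)
    show "\<forall>R \<in> ?C. R \<noteq> [] \<and> distinct R \<and> walk E R"
      using C P' Q' xy(3) disj unfolding path_cover_def by (auto simp: successively_append_iff)
    have *: "set R \<inter> (set P \<union> set Q) = {}" if "R \<in> C - {P, Q}" for R
      using that C PQ unfolding path_cover_def by blast
    show "\<forall>R \<in> ?C. \<forall>R' \<in> ?C. R \<noteq> R' \<longrightarrow> set R \<inter> set R' = {}"
      using C * P'(4) Q'(4) unfolding path_cover_def by auto
    show "\<Union> (set ` ?C) = W" using C PQ P'(4) Q'(4) unfolding path_cover_def by auto
  qed (use fin in simp)
  moreover have "card ?C < card C"
  proof -
    have "card ?C \<le> Suc (card (C - {P, Q}))" using fin by (simp add: card_insert_le_m1 card_insert_if)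
    also have "card (C - {P, Q}) = card C - 2" using fin PQ by (simp add: card_Diff_subset)
    finally show ?thesis using PQ fin card_mono[OF fin, of "{P, Q}"] by auto
  qed
  ultimately show ?thesis by blast
qed

definition min_path_cover :: "'a rel \<Rightarrow> 'a set \<Rightarrow> 'a list set \<Rightarrow> bool" where
  "min_path_cover E W C \<longleftrightarrow> path_cover E W C \<and> (\<forall>C'. path_cover E W C' \<longrightarrow> card C \<le> card C')"

lemma min_path_cover_exists:
  assumes "finite W"
  obtains C where "min_path_cover E W C"
proof -
  have "path_cover E W ((\<lambda>x. [x]) ` W)" unfolding path_cover_def using assms by auto
  thus thesis using that ex_has_least_nat[of "path_cover E W" _ card] unfolding min_path_cover_def by blast
qed

text \<open>The predecessor and the successor on the path serve. They use up two of the available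
  degrees at every inner vertex.\<close>

lemma inner_vertex_nbrs:
  assumes "distinct P" "walk E P" "sym E" "x \<in> set P" "x \<notin> {hd P, last P}"
  shows "\<exists>y z. y \<noteq> z \<and> {y, z} \<subseteq> set P \<and> {y, z} \<subseteq> E `` {x}"
proof -
  obtain m where m: "m < length P" "x = P ! m" using assms(4) by (auto simp: in_set_conv_nth)
  have "P \<noteq> []" using m by auto
  hence "m \<noteq> 0" "m \<noteq> length P - 1"
    using m assms(5) by (metis hd_conv_nth insertI1, metis insertCI last_conv_nth)
  hence m': "0 < m" "Suc m < length P" using m by auto
  hence "(P ! (m - 1), P ! m) \<in> E" "(P ! m, P ! Suc m) \<in> E"
    using successively_nth[OF assms(2), of m] successively_nth[OF assms(2), of "m - 1"] by auto
  moreover have "P ! (m - 1) \<noteq> P ! Suc m" using assms(1) m' by (simp add: nth_eq_iff_index_eq)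
  ultimately show ?thesis using m m' symD[OF assms(3)]
    by (intro exI[of _ "P ! (m - 1)"] exI[of _ "P ! Suc m"]) auto
qed

lemma min_path_cover_ends:
  assumes "min_path_cover E W C" "sym E" "P \<in> C" "Q \<in> C" "P \<noteq> Q"
    "x \<in> {hd P, last P}" "y \<in> {hd Q, last Q}"
  shows "(x, y) \<notin> E"
  using path_cover_merge[OF _ assms(2-7)] assms(1) unfolding min_path_cover_def by (meson not_less)

context sgraph
begin

text \<open>An inner vertex has all its neighbours in \<open>W\<close> on its own path. An edge
  leaving a path would hence join ends of two paths, against minimality.\<close>

lemma min_path_cover_degree2:
  assumes C: "min_path_cover E W C" and W: "W \<subseteq> V" and deg2: "\<And>x. x \<in> W \<Longrightarrow> card (E `` {x} \<inter> W) \<le> 2"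
    and P: "P \<in> C" "x \<in> set P" and y: "y \<in> W" "(x, y) \<in> E"
  shows "y \<in> set P"
proof (rule ccontr)
  assume yP: "y \<notin> set P"
  have pc: "path_cover E W C" using C unfolding min_path_cover_def by simp
  obtain Q where Q: "Q \<in> C" "y \<in> set Q" using pc y unfolding path_cover_def by auto
  have PQ: "P \<noteq> Q" "set P \<inter> set Q = {}"
    using pc Q P yP unfolding path_cover_def by (blast, metis)
  have end_vertex: "a \<in> {hd R, last R}"
    if R: "R \<in> C" "a \<in> set R" and b: "b \<in> W" "(a, b) \<in> E" "b \<notin> set R" for R a b
  proof (rule ccontr)
    assume "a \<notin> {hd R, last R}"
    with R pc sym_E obtain c d where cd: "c \<noteq> d" "{c, d} \<subseteq> set R" "{c, d} \<subseteq> E `` {a}"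
      using inner_vertex_nbrs[of R E a] unfolding path_cover_def by auto
    have RW: "set R \<subseteq> W" using pc R unfolding path_cover_def by auto
    have "{b, c, d} \<subseteq> E `` {a} \<inter> W" using b cd RW by auto
    hence "card {b, c, d} \<le> 2"
      using deg2[of a] R RW card_mono[of "E `` {a} \<inter> W" "{b, c, d}"] by force
    thus False using cd b by (auto simp: card_insert_if split: if_splits)
  qed
  have "x \<in> W" using pc P unfolding path_cover_def by auto
  hence "x \<in> {hd P, last P}" "y \<in> {hd Q, last Q}"
    using end_vertex[OF P y yP] end_vertex[OF Q, of x] E_sym[OF y(2)] PQ P by auto
  with min_path_cover_ends[OF C sym_E P(1) Q(1) PQ(1)] y show False by blast
qed

text \<open>Let \<open>I\<close> be the inner vertices and \<open>Z\<close> those forming one-vertex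
  paths. Counting path ends gives \<open>2 * card C = card W - card I + card Z\<close>. Every
  non-isolated vertex of \<open>Z\<close> is adjacent to an inner vertex, and distinct ones to
  distinct inner vertices, so \<open>card Z\<close> exceeds \<open>card I\<close> by at most the
  number of isolated vertices.\<close>

lemma min_path_cover_degree3:
  assumes C: "min_path_cover E W C" and W: "W \<subseteq> V" and deg3: "\<And>x. x \<in> W \<Longrightarrow> card (E `` {x} \<inter> W) \<le> 3"
  shows "2 * card C \<le> card W + card {x \<in> W. E `` {x} \<inter> W = {}}"
proof -
  have pc: "path_cover E W C" using C unfolding min_path_cover_def by simp
  have finW: "finite W" using W finite_V finite_subset by blast
  have finC: "finite C" using pc unfolding path_cover_def by simp
  define inner where "inner = (\<lambda>P :: 'a list. set P - {hd P, last P})"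
  define I where "I = \<Union> (inner ` C)"
  define Z where "Z = {z. [z] \<in> C}"
  define iso where "iso = {x \<in> W. E `` {x} \<inter> W = {}}"
  have IW: "I \<subseteq> W" "Z \<subseteq> W" using pc unfolding path_cover_def I_def Z_def inner_def by auto
  have disj: "set P \<inter> set Q = {}" if "P \<in> C" "Q \<in> C" "P \<noteq> Q" for P Q
    using pc that unfolding path_cover_def by simp
  have cardW: "card W = (\<Sum>P\<in>C. card (set P))"
  proof -
    have "W = (\<Union>P\<in>C. set P)" using pc unfolding path_cover_def by simp
    thus ?thesis using card_UN_disjoint[OF finC, of set] disj by simp
  qed
  have cardI: "card I = (\<Sum>P\<in>C. card (inner P))"
    unfolding I_def
  proof (rule card_UN_disjoint[OF finC], goal_cases)
    case 2
    show ?case using disj unfolding inner_def by blast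
  qed (simp add: inner_def)
  have splitP: "card (set P) = card (inner P) + card {hd P, last P}" if "P \<in> C" for P
  proof -
    have "{hd P, last P} \<subseteq> set P" using that pc unfolding path_cover_def by auto
    from card_Diff_subset[OF _ this] card_mono[OF _ this] show ?thesis
      unfolding inner_def by simp
  qed
  \<comment> \<open>In a one-vertex path both ends coincide; the correction term counts that vertex
    twice.\<close>
  have ends: "card {hd P, last P} + (if length P = 1 then 1 else 0) = 2" if "P \<in> C" for P
  proof -
    have P: "P \<noteq> []" "distinct P" using that pc unfolding path_cover_def by auto
    show ?thesis
    proof (cases "length P = 1")
      case True thus ?thesis by (auto simp: length_Suc_conv)
    next
      case False
      hence "hd P \<noteq> last P"
        using P by (cases P) (auto simp: last_conv_nth hd_conv_nth nth_Cons' nth_eq_iff_index_eq)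
      thus ?thesis using False by simp
    qed
  qed
  have cardZ: "card Z = (\<Sum>P\<in>C. if length P = 1 then 1 else 0)"
  proof -
    have "(\<lambda>z. [z]) ` Z = {P \<in> C. length P = 1}"
      unfolding Z_def by (auto simp: length_Suc_conv image_iff)
    moreover have "inj_on (\<lambda>z. [z]) Z" by (auto simp: inj_on_def)
    ultimately have "card Z = card {P \<in> C. length P = 1}" by (metis card_image)
    thus ?thesis using finC by (simp add: sum.If_cases Int_def)
  qed
  have twoC: "2 * card C = (\<Sum>P\<in>C. card {hd P, last P}) + card Z"
  proof -
    have "2 * card C = (\<Sum>P\<in>C. 2)" by simp
    also have "\<dots> = (\<Sum>P\<in>C. card {hd P, last P} + (if length P = 1 then 1 else 0))"
      by (rule sum.cong) (simp_all only: ends)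
    finally show ?thesis unfolding cardZ sum.distrib .
  qed
  have W_eq: "card W = card I + (\<Sum>P\<in>C. card {hd P, last P})"
    unfolding cardW cardI sum.distrib[symmetric] by (rule sum.cong) (simp_all only: splitP)
  \<comment> \<open>By minimality a neighbour of \<open>z\<close> cannot be an end of another
    path.\<close>
  have "\<exists>w. (z, w) \<in> E \<and> w \<in> I" if z: "z \<in> Z - iso" for z
  proof -
    obtain w where w: "(z, w) \<in> E" "w \<in> W" using z IW unfolding iso_def by auto
    obtain Q where Q: "Q \<in> C" "w \<in> set Q" using pc w unfolding path_cover_def by auto
    have "Q \<noteq> [z]" using Q w no_loop by auto
    hence "w \<notin> {hd Q, last Q}"
      using min_path_cover_ends[OF C sym_E _ Q(1), of "[z]" z w] w z unfolding Z_def by auto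
    thus ?thesis using w Q unfolding I_def inner_def by auto
  qed
  then obtain f where f: "\<And>z. z \<in> Z - iso \<Longrightarrow> (z, f z) \<in> E \<and> f z \<in> I" by metis
  \<comment> \<open>A shared inner vertex would have as neighbours its two neighbours on the path
    and both one-vertex paths: four in all, against degree 3.\<close>
  have "inj_on f (Z - iso)"
  proof (rule inj_onI, rule ccontr)
    fix z z' assume z: "z \<in> Z - iso" "z' \<in> Z - iso" "f z = f z'" "z \<noteq> z'"
    obtain Q where Q: "Q \<in> C" "f z \<in> set Q" "f z \<notin> {hd Q, last Q}"
      using f[OF z(1)] unfolding I_def inner_def by auto
    obtain c d where cd: "c \<noteq> d" "{c, d} \<subseteq> set Q" "{c, d} \<subseteq> E `` {f z}"
      using inner_vertex_nbrs[of Q E "f z"] Q pc sym_E unfolding path_cover_def by auto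
    have "Q \<noteq> [z]" "Q \<noteq> [z']" using Q by auto
    hence "z \<notin> set Q" "z' \<notin> set Q"
      using z Q(1) pc unfolding path_cover_def Z_def by fastforce+
    hence "c \<noteq> z" "c \<noteq> z'" "d \<noteq> z" "d \<noteq> z'" using cd by auto
    hence four: "card {c, d, z, z'} = 4" using cd(1) z(4) by simp
    have "set Q \<subseteq> W" using pc Q unfolding path_cover_def by auto
    hence "{c, d, z, z'} \<subseteq> E `` {f z} \<inter> W"
      using cd f[OF z(1)] f[OF z(2)] z IW E_sym by auto
    hence "4 \<le> card (E `` {f z} \<inter> W)" using four card_mono[OF finite_Int[OF disjI1[OF finite_nbrs]]] by metis
    moreover have "f z \<in> W" using f[OF z(1)] IW by auto
    ultimately show False using deg3[of "f z"] by simp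
  qed
  hence "card (Z - iso) \<le> card I"
    using f by (intro card_inj_on_le[of f]) (auto intro: finite_subset[OF IW(1) finW])
  moreover have "card Z \<le> card (Z - iso) + card iso"
  proof -
    have "finite ((Z - iso) \<union> iso)" using finW IW unfolding iso_def by (auto intro: finite_subset)
    hence "card Z \<le> card ((Z - iso) \<union> iso)" by (rule card_mono) auto
    also have "\<dots> \<le> card (Z - iso) + card iso" by (rule card_Un_le)
    finally show ?thesis .
  qed
  ultimately show ?thesis using twoC W_eq unfolding iso_def by linarith
qed

end

section \<open>Pancyclicity\<close>

lemma walk_take: "walk E p \<Longrightarrow> walk E (take m p)"
  by (simp add: successively_conv_nth)

lemma walk_drop: "walk E p \<Longrightarrow> walk E (drop m p)"
  by (simp add: successively_conv_nth)

context sgraph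
begin

text \<open>Bondy's argument: without cycles of length \<open>l\<close>, a chord from the first vertex to the one at position \<open>j\<close>
  excludes the chord from the last vertex to the one at position \<open>shift j\<close>, where \<open>shift\<close> is a cyclic
  shift of \<open>{1..n-2}\<close>.\<close>

lemma deg_sum_if_no_cycle:
  assumes c: "cyclic_list E c" "set c = V" and l: "3 \<le> l" "l < card V"
    and no: "\<And>d. cyclic_list E d \<Longrightarrow> length d \<noteq> l"
  shows "deg E (hd c) + deg E (last c) \<le> card V"
proof -
  let ?n = "length c"
  have c': "c \<noteq> []" "distinct c" "walk E c" "(last c, hd c) \<in> E" using c unfolding cyclic_list_iff by auto
  have n: "?n = card V" using c c' distinct_card by metis
  have hd: "hd c = c ! 0" and last: "last c = c ! (?n - 1)"
    using c' by (auto simp: hd_conv_nth last_conv_nth)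
  define J where "J = {j \<in> {1..?n - 2}. (hd c, c ! j) \<in> E}"
  define K where "K = {j \<in> {1..?n - 2}. (last c, c ! j) \<in> E}"
  \<comment> \<open>Both branches close a cycle of length \<open>l\<close>: either
    \<open>hd c\<close>, then \<open>l - 2\<close> consecutive vertices from position
    \<open>j\<close> on, then \<open>last c\<close>; or the segment from \<open>hd c\<close> to
    position \<open>shift j\<close>, then from \<open>last c\<close> backwards to position
    \<open>j\<close> and from there to \<open>hd c\<close>.\<close>
  define shift where "shift = (\<lambda>j. if j \<le> ?n + 1 - l then j + l - 3 else j + l - ?n - 1)"
  have fin: "finite J" "finite K" by (auto simp: J_def K_def)
  \<comment> \<open>Only \<open>last c\<close> can be a neighbour not counted by \<open>J\<close>,
    whence the \<open>Suc\<close>; the same at the other end raises the final bound from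
    \<open>card V - 2\<close> to \<open>card V\<close>.\<close>
  have "E `` {hd c} \<subseteq> insert (last c) ((!) c ` J)"
  proof
    fix y assume y: "y \<in> E `` {hd c}"
    then obtain m where m: "m < ?n" "y = c ! m"
      using nbrs_subset c(2) by (metis in_set_conv_nth subsetD)
    moreover have "m \<noteq> 0" using y m no_loop hd by (metis Image_singleton_iff)
    ultimately show "y \<in> insert (last c) ((!) c ` J)"
      using y by (cases "m = ?n - 1") (auto simp: J_def last)
  qed
  hence "deg E (hd c) \<le> card (insert (last c) ((!) c ` J))"
    unfolding deg_def using fin by (intro card_mono) auto
  also have "\<dots> \<le> Suc (card J)" using card_image_le[OF fin(1), of "(!) c"] fin
    by (simp add: card_insert_if)
  finally have dJ: "deg E (hd c) \<le> Suc (card J)" .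
  have "E `` {last c} \<subseteq> insert (hd c) ((!) c ` K)"
  proof
    fix y assume y: "y \<in> E `` {last c}"
    then obtain m where m: "m < ?n" "y = c ! m"
      using nbrs_subset c(2) by (metis in_set_conv_nth subsetD)
    moreover have "m \<noteq> ?n - 1" using y m no_loop last by (metis Image_singleton_iff)
    ultimately show "y \<in> insert (hd c) ((!) c ` K)"
      using y by (cases "m = 0") (auto simp: K_def hd)
  qed
  hence "deg E (last c) \<le> card (insert (hd c) ((!) c ` K))"
    unfolding deg_def using fin by (intro card_mono) auto
  also have "\<dots> \<le> Suc (card K)" using card_image_le[OF fin(2), of "(!) c"] fin
    by (simp add: card_insert_if)
  finally have dK: "deg E (last c) \<le> Suc (card K)" .
  have inj: "inj_on shift J"
    using l n by (auto simp: inj_on_def shift_def J_def split: if_splits)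
  have ran: "shift ` J \<subseteq> {1..?n - 2}"
    using l n by (auto simp: shift_def J_def split: if_splits)
  have "shift ` J \<inter> K = {}"
  proof (rule ccontr)
    assume "shift ` J \<inter> K \<noteq> {}"
    then obtain j where j: "j \<in> {1..?n - 2}" "(hd c, c ! j) \<in> E" "(last c, c ! shift j) \<in> E"
      by (auto simp: J_def K_def)
    show False
    proof (cases "j \<le> ?n + 1 - l")
      case True
      hence sj: "shift j = j + (l - 3)" using l by (simp add: shift_def)
      define m where "m = take (l - 2) (drop j c)"
      have lm: "length m = l - 2" using True l n by (simp add: m_def)
      hence mne: "m \<noteq> []" using l by auto
      have m: "hd m = c ! j" "last m = c ! shift j" "walk E m" "set m \<subseteq> set c" "distinct m"
        using True l n lm mne c' unfolding sj
        by (auto simp: m_def hd_conv_nth last_conv_nth walk_take walk_drop add.commute numeral_3_eq_3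
              dest: in_set_takeD in_set_dropD)
      have "c ! 0 \<notin> set m" "c ! (?n - 1) \<notin> set m"
        using c'(1,2) j(1) True l n by (auto simp: m_def in_set_conv_nth nth_eq_iff_index_eq)
      moreover have "last c \<noteq> hd c" using no_loop c'(4) by metis
      ultimately have "cyclic_list E (hd c # m @ [last c])"
        unfolding cyclic_list_iff using m j c' mne E_sym hd last
        by (auto simp: successively_Cons successively_append_iff)
      moreover have "length (hd c # m @ [last c]) = l" using lm l by simp
      ultimately show False using no by blast
    next
      case False
      hence sj: "shift j = j + l - ?n - 1" by (simp add: shift_def)
      define k where "k = j + l - ?n - 1"
      have kj: "k < j" "0 < k" "k + 1 + ?n - j = l" using False l n j by (auto simp: k_def)
      define a b where "a = take (Suc k) c" and "b = drop j c"
      have jn: "j < ?n" using j by auto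
      have ab: "a \<noteq> []" "b \<noteq> []" using c' jn by (auto simp: a_def b_def)
      have la: "last a = c ! k" using kj jn by (simp add: a_def take_Suc_conv_app_nth)
      have hb: "hd b = c ! j" using jn by (simp add: b_def hd_drop_conv_nth)
      have ha: "hd a = hd c" using ab by (simp add: a_def)
      have lb: "last b = last c" using jn by (simp add: b_def)
      have disj: "set a \<inter> set b = {}" using c'(2) kj by (auto simp: a_def b_def dest: set_take_disj_set_drop_if_distinct[of c "Suc k" j])
      have "walk E (a @ rev b)"
        unfolding successively_append_iff walk_rev[OF sym_E]
        using c'(3) j(3) la lb E_sym ab by (auto simp: hd_rev sj k_def a_def b_def walk_take walk_drop)
      moreover have "distinct (a @ rev b)" using c'(2) disj by (auto simp: a_def b_def)
      moreover have "(last (a @ rev b), hd (a @ rev b)) \<in> E"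
        using ab ha hb j(2) E_sym by (simp add: last_rev)
      ultimately have "cyclic_list E (a @ rev b)" unfolding cyclic_list_iff using ab by simp
      moreover have "length (a @ rev b) = l" using kj jn by (simp add: a_def b_def)
      ultimately show False using no by blast
    qed
  qed
  hence "card (shift ` J) + card K = card (shift ` J \<union> K)" using fin by (simp add: card_Un_disjoint)
  also have "\<dots> \<le> card {1..?n - 2}" using ran by (intro card_mono) (auto simp: K_def)
  finally have "card J + card K \<le> ?n - 2" using card_image[OF inj] by simp
  thus ?thesis using dJ dK l n by linarith
qed

text \<open>The preceding bound applies to every rotation of the Hamiltonian cycle, hence to each
  pair of consecutive vertices. Summing over all pairs counts each degree twice and yields at most
  \<open>card V * card V\<close>, against \<open>many\<close>.\<close>

lemma cycle_lengths_if_hamiltonian: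
  assumes ham: "hamiltonian V E" and many: "card V * card V < 2 * (\<Sum>x\<in>V. deg E x)"
    and l: "3 \<le> l" "l \<le> card V"
  shows "\<exists>d. cyclic_list E d \<and> length d = l"
proof (rule ccontr)
  assume no: "\<nexists>d. cyclic_list E d \<and> length d = l"
  obtain c where c: "cyclic_list E c" "set c = V" using ham unfolding hamiltonian_def by blast
  have dc: "distinct c" "c \<noteq> []" using c unfolding cyclic_list_def by auto
  have n: "length c = card V" using c dc distinct_card by metis
  have l': "l < card V" using no c n l by (metis le_neq_implies_less)
  have "deg E (c ! i) + deg E (rotate1 c ! i) \<le> card V" if i: "i < length c" for i
  proof -
    let ?c = "rotate (Suc i) c"
    have "hd ?c = c ! (Suc i mod length c)" using dc by (simp add: hd_rotate_conv_nth del: rotate_Suc)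
    moreover have "last ?c = c ! i"
    proof -
      have "last ?c = ?c ! (length c - 1)" using dc by (simp add: last_conv_nth del: rotate_Suc)
      also have "\<dots> = c ! ((Suc i + (length c - 1)) mod length c)"
        using i by (intro nth_rotate) auto
      also have "Suc i + (length c - 1) = i + length c" using i by simp
      finally show ?thesis using i by simp
    qed
    moreover have "cyclic_list E ?c" "set ?c = V"
      using cyclic_list_rotate[OF c(1), of "Suc i"] c(2) by (simp_all del: rotate_Suc)
    ultimately show ?thesis
      using deg_sum_if_no_cycle[of ?c l] l l' no i by (auto simp: nth_rotate1 add.commute)
  qed
  hence "(\<Sum>i<length c. deg E (c ! i) + deg E (rotate1 c ! i)) \<le> (\<Sum>i<length c. card V)"
    by (intro sum_mono) simp
  moreover have "(\<Sum>i<length c. deg E (c ! i)) = (\<Sum>x\<in>V. deg E x)"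
    using dc c(2) by (metis (no_types, lifting) sum.distinct_set_conv_list sum_list_sum_nth length_map nth_map lessThan_atLeast0 sum.cong lessThan_iff)
  moreover have "(\<Sum>i<length c. deg E (rotate1 c ! i)) = (\<Sum>x\<in>V. deg E x)"
    using dc c(2) distinct1_rotate set_rotate1 length_rotate1
    by (metis (no_types, lifting) sum.distinct_set_conv_list sum_list_sum_nth length_map nth_map lessThan_atLeast0 sum.cong lessThan_iff)
  ultimately show False using many n by (simp add: sum.distrib)
qed

end

section \<open>Slack in the edge bound\<close>

text \<open>If \<open>a\<close> vertices have degree at most \<open>i\<close>, \<open>k\<close> others have degree at most \<open>n - 1\<close> and the remaining ones have
  degree at most \<open>n - 1 - a\<close>, then \<open>slack t n a i k\<close> is the excess of the resulting bound on the degree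
  sum over the lower bound on \<open>2m\<close>.\<close>

definition slack :: "int \<Rightarrow> int \<Rightarrow> int \<Rightarrow> int \<Rightarrow> int \<Rightarrow> int" where
  "slack t n a i k = a * (i + k) + (n - a) * (n - 1 - a) - ((n - 2*t) * (n - 2*t - 1) + 6 * t^2)"

text \<open>Reduces the numerical facts to finitely many orders. With \<open>k \<le> i\<close> and
  \<open>i\<close> at most the smaller of \<open>a\<close> and \<open>n - 1 - a\<close>, the slack
  is at most a quadratic in \<open>a\<close>, which is negative beyond order
  \<open>13 * t\<close>.\<close>

lemma order_le_if_slack_nonneg:
  fixes t n a i k :: int
  assumes t: "t \<in> {1, 2, 3}" and n: "9 * t - 2 \<le> n"
    and a: "2 * t + 1 \<le> a" and ia: "i \<le> a" "a + i \<le> n - 1" and k: "k \<le> i"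
    and D: "0 \<le> slack t n a i k"
  shows "n \<le> 13 * t"
proof (rule ccontr)
  assume "\<not> n \<le> 13 * t"
  hence n: "13 * t < n" by simp
  have le: "a * (i + k) \<le> a * (2 * i)" using a t k by (intro mult_left_mono) auto
  have a0: "a \<ge> 0" using a t by auto
  show False
  proof (cases "2 * a \<le> n - 1")
    case True
    have "a * (2 * i) \<le> a * (2 * a)" using ia a0 by (intro mult_left_mono) auto
    with le D have 1: "0 \<le> a * (2 * a) + (n - a) * (n - 1 - a) - ((n - 2*t) * (n - 2*t - 1) + 6 * t^2)"
      unfolding slack_def by linarith
    \<comment> \<open>Products of nonnegative factors reduce the quadratic inequality to linear
      arithmetic; here \<open>a\<close> ranges from \<open>2 * t + 1\<close> to half of
      \<open>n - 1\<close>.\<close>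
    have 2: "0 \<le> (a - (2 * t + 1)) * (n - 1 - 2 * a)" using a True by (intro mult_nonneg_nonneg) auto
    have 3: "0 \<le> (a - (2 * t + 1)) * (n - 13 * t)"
       using a n by (intro mult_nonneg_nonneg) auto
    from t show False using 1 2 3 a n True by (auto simp: algebra_simps power2_eq_square)
  next
    case False
    have "a * (2 * i) \<le> a * (2 * (n - 1 - a))" using ia a0 by (intro mult_left_mono) auto
    with le D have 1: "0 \<le> a * (2 * (n - 1 - a)) + (n - a) * (n - 1 - a) - ((n - 2*t) * (n - 2*t - 1) + 6 * t^2)"
      unfolding slack_def by linarith
    have 2: "n * n \<le> (2 * a) * (2 * a)" using False n t by (intro mult_mono) auto
    have 3: "0 \<le> (n - 13 * t) * (n - 3 * t)"
      using n t by (intro mult_nonneg_nonneg) auto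
    from t show False using 1 2 3 a n False by (auto simp: algebra_simps power2_eq_square)
  qed
qed

text \<open>Once \<open>n\<close> and \<open>a\<close> are fixed, the slack is linear in
  \<open>i + k\<close>, so each pair is decided by linear arithmetic.\<close>

lemma slack_small1:
  fixes n a i k :: int
  assumes n: "7 \<le> n" "n \<le> 13" and a: "3 \<le> a"
    and i: "2 \<le> i" "i \<le> a" "a + i \<le> n - 1" and k: "0 \<le> k" "k \<le> i"
    and D: "0 \<le> slack 1 n a i k"
  shows "4 \<le> a \<Longrightarrow> slack 1 n a i k < 3 * (a - 1) + 3"
    and "k < i \<Longrightarrow> (4 \<le> a \<longrightarrow> slack 1 n a i k < 3 * (a - 1)) \<and> i - k \<le> 1 \<and> 1 \<le> k \<and>
       (n - 1 - a - k \<le> 1 \<or> slack 1 n a i k < n - 1 - 2 * a)"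
proof -
  \<comment> \<open>The upper end for \<open>a\<close> comes from \<open>2 \<le> i\<close> and
    \<open>a + i \<le> n - 1 \<le> 12\<close>.\<close>
  have "n \<in> {7..13}" "a \<in> {3..10}" using n a i by auto
  hence enum: "n = 7 \<or> n = 8 \<or> n = 9 \<or> n = 10 \<or> n = 11 \<or> n = 12 \<or> n = 13"
     "a = 3 \<or> a = 4 \<or> a = 5 \<or> a = 6 \<or> a = 7 \<or> a = 8 \<or> a = 9 \<or> a = 10"
    unfolding set_upto[symmetric] by (simp_all del: set_upto)
  show "4 \<le> a \<Longrightarrow> slack 1 n a i k < 3 * (a - 1) + 3"
    using enum D i k unfolding slack_def
    by (elim disjE; hypsubst; simp; linarith?)
  show "k < i \<Longrightarrow> (4 \<le> a \<longrightarrow> slack 1 n a i k < 3 * (a - 1)) \<and> i - k \<le> 1 \<and> 1 \<le> k \<and>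
       (n - 1 - a - k \<le> 1 \<or> slack 1 n a i k < n - 1 - 2 * a)"
    using enum D i k unfolding slack_def
    by (elim disjE; hypsubst; simp; presburger?)
qed

lemma slack_small2:
  fixes n a i k :: int
  assumes n: "16 \<le> n" "n \<le> 26" and a: "5 \<le> a"
    and i: "4 \<le> i" "i \<le> a" "a + i \<le> n - 1" and k: "0 \<le> k" "k \<le> i"
    and D: "0 \<le> slack 2 n a i k"
  shows "6 \<le> a \<Longrightarrow> slack 2 n a i k < 3 * (a - 1) + 5"
    and "k < i \<Longrightarrow> (6 \<le> a \<longrightarrow> slack 2 n a i k < 3 * (a - 1)) \<and> i - k \<le> 2 \<and> 1 \<le> k \<and>
       (n - 1 - a - k \<le> 2 \<or> slack 2 n a i k < n - 1 - 2 * a)"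
proof -
  have "n \<in> {16..26}" "a \<in> {5..21}" using n a i by auto
  hence enum: "n = 16 \<or> n = 17 \<or> n = 18 \<or> n = 19 \<or> n = 20 \<or> n = 21 \<or> n = 22 \<or> n = 23 \<or> n = 24 \<or> n = 25 \<or> n = 26"
     "a = 5 \<or> a = 6 \<or> a = 7 \<or> a = 8 \<or> a = 9 \<or> a = 10 \<or> a = 11 \<or> a = 12 \<or> a = 13 \<or> a = 14 \<or> a = 15 \<or> a = 16 \<or> a = 17 \<or> a = 18 \<or> a = 19 \<or> a = 20 \<or> a = 21"
    unfolding set_upto[symmetric] by (simp_all del: set_upto)
  show "6 \<le> a \<Longrightarrow> slack 2 n a i k < 3 * (a - 1) + 5"
    using enum D i k unfolding slack_def
    by (elim disjE; hypsubst; simp; linarith?)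
  show "k < i \<Longrightarrow> (6 \<le> a \<longrightarrow> slack 2 n a i k < 3 * (a - 1)) \<and> i - k \<le> 2 \<and> 1 \<le> k \<and>
       (n - 1 - a - k \<le> 2 \<or> slack 2 n a i k < n - 1 - 2 * a)"
    using enum D i k unfolding slack_def
    by (elim disjE; hypsubst; simp; presburger?)
qed

text \<open>The additional lower bounds on \<open>k\<close> feed the counting of paths for degree
  3.\<close>

lemma slack_small3:
  fixes n a i k :: int
  assumes n: "28 \<le> n" "n \<le> 39" and a: "7 \<le> a"
    and i: "6 \<le> i" "i \<le> a" "a + i \<le> n - 1" and k: "0 \<le> k" "k \<le> i"
    and D: "0 \<le> slack 3 n a i k"
  shows "8 \<le> a \<Longrightarrow> slack 3 n a i k < 3 * (a - 1) + 7"
    and "k < i \<Longrightarrow> (8 \<le> a \<longrightarrow> slack 3 n a i k < 3 * (a - 1)) \<and> i - k \<le> 3 \<and> a - 3 \<le> k \<and> 11 \<le> k \<and>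
       (n - 1 - a - k \<le> 3 \<or> slack 3 n a i k < n - 1 - 2 * a)"
proof -
  have "n \<in> {28..39}" "a \<in> {7..32}" using n a i by auto
  hence enum: "n = 28 \<or> n = 29 \<or> n = 30 \<or> n = 31 \<or> n = 32 \<or> n = 33 \<or> n = 34 \<or> n = 35 \<or> n = 36 \<or> n = 37 \<or> n = 38 \<or> n = 39"
     "a = 7 \<or> a = 8 \<or> a = 9 \<or> a = 10 \<or> a = 11 \<or> a = 12 \<or> a = 13 \<or> a = 14 \<or> a = 15 \<or> a = 16 \<or> a = 17 \<or> a = 18 \<or> a = 19 \<or> a = 20 \<or> a = 21 \<or> a = 22 \<or> a = 23 \<or> a = 24 \<or> a = 25 \<or> a = 26 \<or> a = 27 \<or> a = 28 \<or> a = 29 \<or> a = 30 \<or> a = 31 \<or> a = 32"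
    unfolding set_upto[symmetric] by (simp_all del: set_upto)
  show "8 \<le> a \<Longrightarrow> slack 3 n a i k < 3 * (a - 1) + 7"
    using enum D i k unfolding slack_def
    by (elim disjE; hypsubst; simp; linarith?)
  show "k < i \<Longrightarrow> (8 \<le> a \<longrightarrow> slack 3 n a i k < 3 * (a - 1)) \<and> i - k \<le> 3 \<and> a - 3 \<le> k \<and> 11 \<le> k \<and>
       (n - 1 - a - k \<le> 3 \<or> slack 3 n a i k < n - 1 - 2 * a)"
    using enum D i k unfolding slack_def
    by (elim disjE; hypsubst; simp; presburger?)
qed

text \<open>The first fact excludes two non-universal vertices of large degree, the second excludes
  one. The third makes the set of universal vertices nonempty and bounds degrees outside it, the
  fourth separates the case of bounded degree from that of a clique, and the fifth serves the path
  counting for \<open>t = 3\<close>.\<close>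

lemma slack_facts:
  fixes t n a i k :: int
  assumes tn: "t = 1 \<and> 7 \<le> n \<or> t = 2 \<and> 16 \<le> n \<or> t = 3 \<and> 28 \<le> n"
    and i: "2 * t \<le> i" "i \<le> a" "a + i \<le> n - 1" and k: "0 \<le> k" "k \<le> i"
    and D: "0 \<le> slack t n a i k"
  shows "2 * t + 2 \<le> a \<Longrightarrow> slack t n a i k < 3 * (a - 1) + (2 * t + 1)"
    and "k < i \<Longrightarrow> 2 * t + 2 \<le> a \<Longrightarrow> slack t n a i k < 3 * (a - 1)"
    and "k < i \<Longrightarrow> i - k \<le> t \<and> 1 \<le> k"
    and "k < i \<Longrightarrow> n - 1 - a - k \<le> t \<or> slack t n a i k < n - 1 - 2 * a"
    and "k < i \<Longrightarrow> t = 3 \<Longrightarrow> a - 3 \<le> k \<and> (11 \<le> k \<or> k < 6 \<and> slack t n a i k < n - 1 - 2 * a)"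
proof -
  have *: "(2 * t + 2 \<le> a \<longrightarrow> slack t n a i k < 3 * (a - 1) + (2 * t + 1)) \<and>
    (k < i \<longrightarrow> (2 * t + 2 \<le> a \<longrightarrow> slack t n a i k < 3 * (a - 1)) \<and> i - k \<le> t \<and> 1 \<le> k \<and>
      (n - 1 - a - k \<le> t \<or> slack t n a i k < n - 1 - 2 * a) \<and>
      (t = 3 \<longrightarrow> a - 3 \<le> k \<and> (11 \<le> k \<or> k < 6 \<and> slack t n a i k < n - 1 - 2 * a)))"
  proof (cases "a = 2 * t")
    \<comment> \<open>Here also \<open>i = 2 * t\<close>, and the slack is
      \<open>2 * t * (k - t)\<close> whatever the order. For larger \<open>a\<close> the order is at
      most \<open>13 * t\<close> and the finite checks apply.\<close>
    case True
    with i have "i = 2 * t" by simp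
    with True D k tn show ?thesis
      by (elim disjE conjE) (auto simp: slack_def algebra_simps power2_eq_square)
  next
    case False
    with i have a: "2 * t + 1 \<le> a" by simp
    have n: "n \<le> 13 * t"
      using order_le_if_slack_nonneg[of t n a i k] tn a i k D by auto
    from tn show ?thesis
    proof (elim disjE conjE)
      assume t: "t = 1" and "7 \<le> n"
      then show ?thesis using slack_small1[of n a i k] n a i k D unfolding t by simp
    next
      assume t: "t = 2" and "16 \<le> n"
      then show ?thesis using slack_small2[of n a i k] n a i k D unfolding t by simp
    next
      assume t: "t = 3" and "28 \<le> n"
      then show ?thesis using slack_small3[of n a i k] n a i k D unfolding t by auto
    qed
  qed
  show "2 * t + 2 \<le> a \<Longrightarrow> slack t n a i k < 3 * (a - 1) + (2 * t + 1)"
    and "k < i \<Longrightarrow> 2 * t + 2 \<le> a \<Longrightarrow> slack t n a i k < 3 * (a - 1)"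
    and "k < i \<Longrightarrow> i - k \<le> t \<and> 1 \<le> k"
    and "k < i \<Longrightarrow> n - 1 - a - k \<le> t \<or> slack t n a i k < n - 1 - 2 * a"
    and "k < i \<Longrightarrow> t = 3 \<Longrightarrow> a - 3 \<le> k \<and> (11 \<le> k \<or> k < 6 \<and> slack t n a i k < n - 1 - 2 * a)"
    using * by blast+
qed

section \<open>Tough graphs with many edges are Hamiltonian\<close>

text \<open>For symmetric \<open>E\<close>, the members of \<open>F\<close> are disjoint nonempty
  unions of components of the graph induced on \<open>W\<close>, so \<open>card F\<close> bounds the
  number of components from below.\<close>

definition separated :: "'a rel \<Rightarrow> 'a set \<Rightarrow> 'a set set \<Rightarrow> bool" where
  "separated E W F \<longleftrightarrow>
     (\<forall>X \<in> F. X \<noteq> {} \<and> X \<subseteq> W \<and> (\<forall>x \<in> X. \<forall>y \<in> W. (x, y) \<in> E \<longrightarrow> y \<in> X)) \<and>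
     (\<forall>X \<in> F. \<forall>Y \<in> F. X \<noteq> Y \<longrightarrow> X \<inter> Y = {})"

text \<open>Toughness read through such families; a family with two members witnesses that
  \<open>S\<close> is a cutset.\<close>

definition separation_bound :: "nat \<Rightarrow> 'a set \<Rightarrow> 'a rel \<Rightarrow> bool" where
  "separation_bound t V E \<longleftrightarrow>
     (\<forall>S F. S \<subseteq> V \<and> separated E (V - S) F \<and> 2 \<le> card F \<longrightarrow> t * card F \<le> card S)"

text \<open>A family separated in the larger graph is separated in the smaller one.\<close>

lemma separation_bound_mono: "separation_bound t V E \<Longrightarrow> E \<subseteq> E' \<Longrightarrow> separation_bound t V E'"
  unfolding separation_bound_def separated_def by (meson subsetD)

lemma separated_insert:
  assumes F: "separated E W F" and Y: "Y \<noteq> {}" "Y \<subseteq> W" "\<And>X. X \<in> F \<Longrightarrow> Y \<inter> X = {}"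
    and cl: "\<And>x y. x \<in> Y \<Longrightarrow> y \<in> W \<Longrightarrow> (x, y) \<in> E \<Longrightarrow> y \<in> Y"
  shows "separated E W (insert Y F)"
  unfolding separated_def
proof (intro conjI ballI impI)
  fix X assume X: "X \<in> insert Y F"
  show "X \<noteq> {}" "X \<subseteq> W" using X Y F unfolding separated_def by blast+
  fix x y assume "x \<in> X" "y \<in> W" "(x, y) \<in> E"
  thus "y \<in> X" using X F cl unfolding separated_def by blast
next
  fix X X' assume "X \<in> insert Y F" "X' \<in> insert Y F" "X \<noteq> X'"
  moreover have "X \<inter> Y = {}" if "X \<in> F" for X using Y(3)[OF that] by blast
  ultimately show "X \<inter> X' = {}" using F Y(3) unfolding separated_def by (metis insertE)
qed

lemma separated_empty: "separated E W {}"
  unfolding separated_def by simp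

text \<open>The hypothetical counterexample after saturation. \<open>max_sum\<close> and
  \<open>max_deg\<close> make the pair lexicographically maximal, first in degree sum, then in the
  degree of the second vertex. The left side of \<open>size\<close> expands to the numerator of the
  spectral bound.\<close>

locale extremal_pair = sgraph V E for V :: "'a set" and E +
  fixes t n :: nat and u v :: 'a
  assumes n: "n = card V"
    and tn: "t = 1 \<and> 7 \<le> n \<or> t = 2 \<and> 16 \<le> n \<or> t = 3 \<and> 28 \<le> n"
    and tough: "separation_bound t V E"
    and not_ham: "\<not> hamiltonian V E"
    and u: "u \<in> V" and v: "v \<in> V" and u_neq_v: "u \<noteq> v" and uv: "(u, v) \<notin> E"
    and ore: "deg E u + deg E v \<le> n - 1"
    and max_sum: "\<And>x y. x \<in> V \<Longrightarrow> y \<in> V \<Longrightarrow> x \<noteq> y \<Longrightarrow> (x, y) \<notin> E \<Longrightarrow>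
      deg E x + deg E y \<le> deg E u + deg E v"
    and max_deg: "\<And>x y. x \<in> V \<Longrightarrow> y \<in> V \<Longrightarrow> x \<noteq> y \<Longrightarrow> (x, y) \<notin> E \<Longrightarrow>
      deg E x + deg E y = deg E u + deg E v \<Longrightarrow> deg E y \<le> deg E v"
    and size: "(int n - 2 * int t) * (int n - 2 * int t - 1) + 6 * (int t)^2 \<le> (\<Sum>x\<in>V. int (deg E x))"
begin

section \<open>Degree classes and shortfalls from their bounds\<close>

definition low :: "'a set" where "low = V - {v} - E `` {v}"
definition high :: "'a set" where "high = {x \<in> V. deg E v < deg E x}"
definition rest :: "'a set" where "rest = V - low - high"

text \<open>Shortfall of a degree from the largest value its class allows; the slack will bound the
  sum of all shortfalls.\<close>

definition gap :: "'a \<Rightarrow> int" where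
  "gap x = (if x \<in> low then int (deg E u) else if x \<in> high then int n - 1 else int (deg E v)) - int (deg E x)"

abbreviation slk :: int where
  "slk \<equiv> slack (int t) (int n) (int (card low)) (int (deg E u)) (int (card high))"

lemma t_pos: "1 \<le> t" and n_large: "7 \<le> n"
  using tn by auto

lemma u_le_v: "deg E u \<le> deg E v"
  using max_deg[OF v u] u_neq_v uv E_sym by fastforce

lemma finite_sets [simp]: "finite low" "finite high" "finite rest"
  using finite_V unfolding low_def high_def rest_def by auto

lemma card_low: "card low + deg E v = n - 1"
  using deg_add_nonnbrs[OF v] unfolding low_def n by simp

lemma u_le_card_low: "deg E u \<le> card low"
  using card_low ore by linarith

lemma low_deg:
  assumes "x \<in> low"
  shows "deg E x \<le> deg E u"
proof -
  have "x \<in> V" "x \<noteq> v" "(x, v) \<notin> E" using assms E_sym unfolding low_def by auto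
  from max_sum[OF this(1) v this(2,3)] show ?thesis by simp
qed

lemma high_disjoint: "low \<inter> high = {}"
  using low_deg u_le_v unfolding high_def by fastforce

text \<open>A missing edge would give a pair with larger degree sum than \<open>u\<close> and
  \<open>v\<close>, since \<open>deg E s\<close> exceeds \<open>deg E v\<close>.\<close>

lemma high_adj:
  assumes "s \<in> high" "w \<in> V" "w \<noteq> s" "deg E u \<le> deg E w"
  shows "(s, w) \<in> E"
  using max_sum[of s w] assms unfolding high_def by fastforce

lemma high_subset: "high \<subseteq> E `` {u}"
proof
  fix s assume s: "s \<in> high"
  have "s \<noteq> u" using s u_le_v unfolding high_def by auto
  thus "s \<in> E `` {u}" using high_adj[OF s u] E_sym by auto
qed

lemma card_high: "card high \<le> deg E u"
  unfolding deg_def by (rule card_mono[OF finite_nbrs high_subset])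

lemma rest_deg: "x \<in> rest \<Longrightarrow> deg E x \<le> deg E v"
  unfolding rest_def high_def by auto

lemma v_rest: "v \<in> rest"
  using v unfolding rest_def low_def high_def by auto

lemma partition: "low \<union> high \<union> rest = V" "low \<inter> rest = {}" "high \<inter> rest = {}"
  unfolding rest_def low_def high_def by auto

lemma card_partition: "n = card low + card high + card rest"
proof -
  have "card (low \<union> high \<union> rest) = card (low \<union> high) + card rest"
    by (rule card_Un_disjoint) (use partition(2,3) in auto)
  thus ?thesis using card_Un_disjoint[OF _ _ high_disjoint] n partition(1) by simp
qed

text \<open>The neighbourhood of \<open>x\<close> separates \<open>x\<close> from its
  non-neighbours, which gives two parts; a vertex without non-neighbours has degree
  \<open>n - 1\<close>.\<close>

lemma min_deg:
  assumes x: "x \<in> V"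
  shows "2 * t \<le> deg E x"
proof (cases "V - {x} - E `` {x} = {}")
  case True
  hence "deg E x = n - 1" using deg_add_nonnbrs[OF x] n by (metis add.right_neutral card.empty)
  thus ?thesis using tn by auto
next
  case False
  let ?Y = "V - {x} - E `` {x}"
  have "separated E (V - E `` {x}) {{x}, ?Y}"
    unfolding separated_def using False x no_loop E_sym by auto
  moreover have "{x} \<noteq> ?Y" by auto
  hence "card {{x}, ?Y} = 2" by simp
  ultimately show ?thesis
    using tough nbrs_subset[of x] unfolding separation_bound_def deg_def
    by (metis dual_order.refl mult.commute)
qed

lemma gap_nonneg:
  assumes "x \<in> V"
  shows "0 \<le> gap x"
proof -
  have "deg E x \<le> n - 1" using deg_le[OF assms] n by simp
  thus ?thesis using low_deg rest_deg assms n_large unfolding gap_def rest_def by auto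
qed

text \<open>With \<open>a = card low\<close>, \<open>k = card high\<close> and
  \<open>i = deg E u\<close>, the class bounds add up to
  \<open>a * i + k * (n - 1) + (n - a - k) * (n - 1 - a)\<close>, which regroups to the positive
  part of \<open>slack\<close>; \<open>size\<close> bounds the degree sum from below.\<close>

lemma sum_gap: "(\<Sum>x\<in>V. gap x) \<le> slk"
proof -
  have "(\<Sum>x\<in>V. gap x + int (deg E x)) =
    (\<Sum>x\<in>low. gap x + int (deg E x)) + (\<Sum>x\<in>high. gap x + int (deg E x)) + (\<Sum>x\<in>rest. gap x + int (deg E x))"
  proof -
    have "(\<Sum>x\<in>low \<union> high \<union> rest. gap x + int (deg E x)) =
      (\<Sum>x\<in>low. gap x + int (deg E x)) + (\<Sum>x\<in>high. gap x + int (deg E x)) + (\<Sum>x\<in>rest. gap x + int (deg E x))"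
      by (simp add: sum.union_disjoint high_disjoint partition(2,3) Int_Un_distrib2)
    thus ?thesis unfolding partition(1) .
  qed
  also have "(\<Sum>x\<in>low. gap x + int (deg E x)) = int (card low) * int (deg E u)"
    by (simp add: gap_def)
  also have "(\<Sum>x\<in>high. gap x + int (deg E x)) = (\<Sum>x\<in>high. int n - 1)"
    by (rule sum.cong) (use high_disjoint in \<open>auto simp: gap_def\<close>)
  also have "\<dots> = int (card high) * (int n - 1)" by simp
  also have "(\<Sum>x\<in>rest. gap x + int (deg E x)) = (\<Sum>x\<in>rest. int (deg E v))"
    by (rule sum.cong) (use partition in \<open>auto simp: gap_def\<close>)
  also have "\<dots> = int (card rest) * int (deg E v)" by simp
  finally have eq: "(\<Sum>x\<in>V. gap x) + (\<Sum>x\<in>V. int (deg E x)) =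
    int (card low) * int (deg E u) + int (card high) * (int n - 1) + int (card rest) * int (deg E v)"
    by (simp add: sum.distrib)
  have j: "int (deg E v) = int n - 1 - int (card low)" using card_low n_large by linarith
  have r: "int (card rest) = int n - int (card low) - int (card high)" using card_partition by linarith
  show ?thesis using eq size unfolding slack_def j r by (simp add: algebra_simps)
qed

lemma sum_gap_le:
  assumes "X \<subseteq> V"
  shows "(\<Sum>x\<in>X. gap x) \<le> slk"
proof -
  have "(\<Sum>x\<in>X. gap x) \<le> (\<Sum>x\<in>V. gap x)"
    by (rule sum_mono2[OF finite_V assms]) (use gap_nonneg in blast)
  thus ?thesis using sum_gap by linarith
qed

section \<open>Vertices of large degree are universal\<close>

lemmas slk_facts = slack_facts[of "int t" "int n" "int (deg E u)" "int (card low)" "int (card high)"]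

lemma slack_hyps:
  "int t = 1 \<and> 7 \<le> int n \<or> int t = 2 \<and> 16 \<le> int n \<or> int t = 3 \<and> 28 \<le> int n"
  "2 * int t \<le> int (deg E u)" "int (deg E u) \<le> int (card low)"
  "int (card low) + int (deg E u) \<le> int n - 1" "0 \<le> int (card high)" "int (card high) \<le> int (deg E u)"
  "0 \<le> slk"
proof -
  show "int t = 1 \<and> 7 \<le> int n \<or> int t = 2 \<and> 16 \<le> int n \<or> int t = 3 \<and> 28 \<le> int n" using tn by auto
  show "2 * int t \<le> int (deg E u)" using min_deg[OF u] by linarith
  show "int (deg E u) \<le> int (card low)" using u_le_card_low by simp
  show "int (card low) + int (deg E u) \<le> int n - 1" using card_low u_le_v n_large by linarith
  show "0 \<le> int (card high)" "int (card high) \<le> int (deg E u)" using card_high by simp_all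
  show "0 \<le> slk" using sum_gap_le[of "{}"] by simp
qed

text \<open>Let \<open>a = card low\<close> and let \<open>m\<close> be the number of non-neighbours
  of \<open>s\<close>. Then \<open>s\<close> falls short by \<open>m\<close> and each non-neighbour
  by at least \<open>a + 1 - m\<close>, in total \<open>m * (a + 2 - m)\<close>. This concave
  function is at least \<open>3 * (a - 1)\<close> for \<open>m\<close> between 3 and
  \<open>a - 1\<close>.\<close>

lemma high_missing:
  assumes s: "s \<in> high" and X: "X = V - {s} - E `` {s}" and ne: "X \<noteq> {}"
  shows "3 * (int (card low) - 1) \<le> (\<Sum>x\<in>insert s X. gap x)"
    and "2 * int t + 2 \<le> int (card low)" and "2 * int t + 1 \<le> gap s"
    and "\<And>w. w \<in> X \<Longrightarrow> deg E w < deg E u"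
proof -
  define m where "m = int (card X)"
  have sV: "s \<in> V" "deg E v < deg E s" using s unfolding high_def by auto
  have m: "int (deg E s) = int n - 1 - m"
    using deg_add_nonnbrs[OF sV(1)] n n_large unfolding m_def X by linarith
  have a: "int (deg E v) = int n - 1 - int (card low)" using card_low n_large by linarith
  have fX: "finite X" "s \<notin> X" using finite_V X by auto
  have w: "deg E w < deg E u" "int (deg E w) \<le> int (deg E u) - int (card low) + m - 1"
      "int (card low) + 1 - m \<le> gap w" if wX: "w \<in> X" for w
  proof -
    have w: "w \<in> V" "w \<noteq> s" "(s, w) \<notin> E" "(w, s) \<notin> E" using wX X E_sym by auto
    show less: "deg E w < deg E u" using high_adj[OF s w(1,2)] w by linarith
    \<comment> \<open>Equal sums would force \<open>deg E s \<le> deg E v\<close> by the tie-break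
      in the choice of the pair, but \<open>s\<close> is in \<open>high\<close>.\<close>
    have "deg E w + deg E s \<noteq> deg E u + deg E v"
      using max_deg[OF w(1) sV(1) w(2,4)] sV by auto
    hence "deg E w + deg E s < deg E u + deg E v"
      using max_sum[OF w(1) sV(1) w(2,4)] by simp
    thus dw: "int (deg E w) \<le> int (deg E u) - int (card low) + m - 1" using m a by linarith
    have "w \<notin> high" using less u_le_v unfolding high_def by auto
    hence "int (deg E u) - int (deg E w) \<le> gap w" unfolding gap_def using u_le_v by auto
    thus "int (card low) + 1 - m \<le> gap w" using dw by linarith
  qed
  show "\<And>w. w \<in> X \<Longrightarrow> deg E w < deg E u" using w(1) by blast
  obtain w0 where w0: "w0 \<in> X" using ne by auto
  hence "2 * t \<le> deg E w0" using min_deg X by auto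
  hence m_lo: "2 * int t + 1 \<le> m" using w(2)[OF w0] u_le_card_low by linarith
  have m_hi: "m \<le> int (card low) - 1" using m a sV(2) by linarith
  show "2 * int t + 2 \<le> int (card low)" using m_lo m_hi by linarith
  have gs: "gap s = m" using s high_disjoint m unfolding gap_def by auto
  thus "2 * int t + 1 \<le> gap s" using m_lo by simp
  have "3 * (int (card low) - 1) \<le> m + m * (int (card low) + 1 - m)"
  proof -
    have "0 \<le> (m - 3) * (int (card low) - 1 - m)"
      using m_lo m_hi t_pos by (intro mult_nonneg_nonneg) auto
    thus ?thesis by (simp add: algebra_simps)
  qed
  also have "m * (int (card low) + 1 - m) = (\<Sum>w\<in>X. int (card low) + 1 - m)"
    by (simp add: m_def)
  also have "\<dots> \<le> (\<Sum>w\<in>X. gap w)" by (intro sum_mono w(3))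
  finally show "3 * (int (card low) - 1) \<le> (\<Sum>x\<in>insert s X. gap x)"
    using fX gs by simp
qed

text \<open>Suppose equality. If all neighbours of \<open>low\<close> were in \<open>high\<close>,
  removing \<open>high\<close> would leave more parts than toughness allows. So some
  \<open>w\<close> in \<open>low\<close> has a neighbour elsewhere; it then misses two vertices of
  \<open>high\<close>, and these two together cost more than the slack.\<close>

lemma card_high_less: "card high < deg E u"
proof (rule ccontr)
  assume "\<not> card high < deg E u"
  hence k: "card high = deg E u" using card_high by simp
  have "\<exists>w \<in> low. \<exists>y \<in> V - high. (w, y) \<in> E"
  proof (rule ccontr)
    assume no: "\<not> ?thesis"
    \<comment> \<open>Every vertex of \<open>low\<close> is a part of its own and
      \<open>rest\<close> is one more, while \<open>high\<close> has at most \<open>card low\<close>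
      vertices.\<close>
    define F where "F = insert rest ((\<lambda>w. {w}) ` low)"
    have "separated E (V - high) F"
      unfolding separated_def
    proof (intro conjI ballI impI)
      fix X assume X: "X \<in> F"
      show "X \<noteq> {}" "X \<subseteq> V - high"
        using X v_rest partition high_disjoint unfolding F_def by blast+
      fix x y assume x: "x \<in> X" and y: "y \<in> V - high" "(x, y) \<in> E"
      have "x \<in> V - high" using x \<open>X \<subseteq> V - high\<close> by blast
      hence "x \<notin> low" "y \<notin> low" using no y E_sym by blast+
      thus "y \<in> X" using x y X partition(1) unfolding F_def by blast
    next
      fix X Y assume "X \<in> F" "Y \<in> F" "X \<noteq> Y"
      thus "X \<inter> Y = {}" using partition(2) unfolding F_def by blast
    qed
    moreover have "card F = card low + 1"
    proof -
      have "card ((\<lambda>w. {w}) ` low) = card low" by (rule card_image) auto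
      moreover have "rest \<notin> (\<lambda>w. {w}) ` low" using v_rest partition by auto
      ultimately show ?thesis unfolding F_def by simp
    qed
    moreover have "1 \<le> card low" using u_le_card_low min_deg[OF u] t_pos by linarith
    moreover have "high \<subseteq> V" unfolding high_def by auto
    ultimately have "t * (card low + 1) \<le> card high"
      using tough unfolding separation_bound_def by (metis Suc_1 Suc_eq_plus1 add_le_mono1 plus_1_eq_Suc)
    moreover have "card low + 1 \<le> t * (card low + 1)" using mult_le_mono1[OF t_pos, of "card low + 1"] by simp
    ultimately show False using card_high u_le_card_low by linarith
  qed
  then obtain w y where w: "w \<in> low" and y: "y \<in> V" "y \<notin> high" "(w, y) \<in> E" by blast
  have wV: "w \<in> V" "w \<notin> high" using w high_disjoint unfolding low_def by auto
  have "E `` {w} \<inter> high \<subseteq> E `` {w} - {y}" using y by auto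
  hence "card (E `` {w} \<inter> high) \<le> card (E `` {w} - {y})" by (intro card_mono) auto
  also have "\<dots> = deg E w - 1" using y unfolding deg_def by simp
  finally have c1: "card (E `` {w} \<inter> high) \<le> deg E w - 1" .
  have dpos: "0 < deg E w" using min_deg[OF wV(1)] t_pos by linarith
  have dw: "deg E w < deg E u"
  proof (rule ccontr)
    assume "\<not> deg E w < deg E u"
    hence "deg E w = deg E u" using low_deg[OF w] by simp
    hence "high \<subseteq> E `` {w}" using high_adj[OF _ wV(1)] wV E_sym by auto
    hence "card (E `` {w} \<inter> high) = card high" by (simp add: Int_absorb1)
    thus False using c1 k \<open>deg E w = deg E u\<close> dpos by linarith
  qed
  have "card high = card (E `` {w} \<inter> high) + card (high - E `` {w})"
    using card_Int_Diff[OF finite_sets(2), of "E `` {w}"] by (simp add: Int_commute)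
  \<comment> \<open>At least one neighbour of \<open>w\<close> lies outside \<open>high\<close>, and
    \<open>deg E w\<close> is less than \<open>card high\<close>.\<close>
  hence two: "2 \<le> card (high - E `` {w})" using c1 dw dpos k by linarith
  then obtain s1 s2 where s: "s1 \<in> high" "s2 \<in> high" "s1 \<noteq> s2" "(w, s1) \<notin> E" "(w, s2) \<notin> E"
    by (auto simp: numeral_2_eq_2 card_le_Suc_iff)
  define X1 where "X1 = V - {s1} - E `` {s1}"
  define X2 where "X2 = V - {s2} - E `` {s2}"
  have wX: "w \<in> X1" "w \<in> X2" using s wV E_sym unfolding X1_def X2_def by auto
  have ne: "X1 \<noteq> {}" "X2 \<noteq> {}" using wX by auto
  note m1 = high_missing[OF s(1) X1_def ne(1)]
  note m2 = high_missing[OF s(2) X2_def ne(2)]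
  \<comment> \<open>The vertices of \<open>X1\<close> have degree below \<open>deg E u\<close>, so
    the shortfall of \<open>s2\<close> comes in addition.\<close>
  have "s2 \<notin> insert s1 X1" using m1(4)[of s2] s u_le_v unfolding high_def by auto
  moreover have "finite X1" using finite_V unfolding X1_def by simp
  ultimately have "(\<Sum>x\<in>insert s2 (insert s1 X1). gap x) = gap s2 + (\<Sum>x\<in>insert s1 X1. gap x)"
    by simp
  moreover have "insert s2 (insert s1 X1) \<subseteq> V" using s unfolding X1_def high_def by auto
  ultimately have "3 * (int (card low) - 1) + (2 * int t + 1) \<le> slk"
    using sum_gap_le[of "insert s2 (insert s1 X1)"] m1(1) m2(3) by linarith
  thus False using slk_facts(1)[OF slack_hyps m1(2)] by linarith
qed

text \<open>A missing edge at \<open>s\<close> forces \<open>card low\<close> to be at least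
  \<open>2 * t + 2\<close> and costs at least \<open>3 * (card low - 1)\<close>, more than the slack
  when \<open>card high\<close> is less than \<open>deg E u\<close>.\<close>

lemma high_universal:
  assumes s: "s \<in> high" and y: "y \<in> V" "y \<noteq> s"
  shows "(s, y) \<in> E \<and> (y, s) \<in> E"
proof (rule ccontr)
  define X where "X = V - {s} - E `` {s}"
  assume "\<not> ?thesis"
  hence ne: "X \<noteq> {}" using y E_sym unfolding X_def by auto
  note m = high_missing[OF s X_def ne]
  have "insert s X \<subseteq> V" using s unfolding X_def high_def by auto
  hence "3 * (int (card low) - 1) \<le> slk" using sum_gap_le[of "insert s X"] m(1) by linarith
  thus False using slk_facts(2)[OF slack_hyps _ m(2)] card_high_less by linarith
qed

section \<open>Path covers outside the universal vertices\<close>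

lemma nbrs_outside_high:
  assumes x: "x \<in> V - high"
  shows "card (E `` {x} \<inter> (V - high)) = deg E x - card high"
proof -
  have "high \<subseteq> E `` {x}"
  proof
    fix s assume s: "s \<in> high"
    hence "x \<noteq> s" using x by auto
    thus "s \<in> E `` {x}" using high_universal[OF s, of x] x by simp
  qed
  moreover have "E `` {x} \<inter> (V - high) = E `` {x} - high" using nbrs_subset by auto
  ultimately show ?thesis unfolding deg_def by (simp add: card_Diff_subset)
qed

text \<open>Two nonadjacent vertices of \<open>rest\<close> would need more slack. Once \<open>rest\<close> is a clique, the degree bound
  leaves its vertices no further neighbours outside \<open>high\<close>.\<close>

lemma rest_clique:
  assumes few: "slk < int n - 1 - 2 * int (card low)" and x: "x \<in> rest"
  shows "E `` {x} \<inter> (V - high) = rest - {x}"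
proof -
  have a: "int (deg E v) = int n - 1 - int (card low)" using card_low n_large by linarith
  have adj: "(x, y) \<in> E" if y: "y \<in> rest" "y \<noteq> x" for y
  proof (rule ccontr)
    assume no: "(x, y) \<notin> E"
    have V: "x \<in> V" "y \<in> V" using x y partition by auto
    have "deg E x + deg E y \<le> n - 1" using max_sum[OF V y(2)[symmetric] no] ore by linarith
    moreover have "gap x = int (deg E v) - int (deg E x)" "gap y = int (deg E v) - int (deg E y)"
      using x y partition unfolding gap_def by auto
    moreover have "gap x + gap y \<le> slk" using sum_gap_le[of "{x, y}"] V y by simp
    ultimately show False using few a n_large by linarith
  qed
  have xV: "x \<in> V - high" using x partition by auto
  have "rest - {x} \<subseteq> E `` {x} \<inter> (V - high)" using adj partition by auto
  moreover have "card (E `` {x} \<inter> (V - high)) \<le> card (rest - {x})"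
  proof -
    have "card (rest - {x}) = card rest - 1" using x by simp
    thus ?thesis using nbrs_outside_high[OF xV] rest_deg[OF x] card_low card_partition by linarith
  qed
  ultimately show ?thesis by (metis card_seteq finite_Int finite_nbrs)
qed

text \<open>Otherwise the universal vertices of \<open>high\<close> would join the paths to a
  Hamiltonian cycle.\<close>

lemma path_cover_large:
  assumes "path_cover E (V - high) C"
  shows "card high < card C"
proof (rule ccontr)
  assume "\<not> card high < card C"
  moreover have "high \<noteq> {}"
  proof -
    have "1 \<le> int (card high)" using slk_facts(3)[OF slack_hyps] card_high_less by linarith
    thus ?thesis by auto
  qed
  moreover have "high \<subseteq> V" unfolding high_def by auto
  moreover have "2 \<le> card V" using n n_large by simp
  ultimately have "hamiltonian V E"
    by (intro hamiltonian_if_path_cover[OF finite_V _ _ _ _ assms] high_universal) auto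
  thus False using not_ham by blast
qed

text \<open>The second bound extends to families with at most one member because \<open>high\<close>
  is nonempty.\<close>

lemma separation:
  assumes "separated E (V - high) F"
  shows "2 \<le> card F \<Longrightarrow> t * card F \<le> card high" and "card F \<le> card high"
proof -
  have high: "high \<subseteq> V" unfolding high_def by auto
  show *: "2 \<le> card F \<Longrightarrow> t * card F \<le> card high"
    using tough assms high unfolding separation_bound_def by blast
  have "1 \<le> int (card high)" using slk_facts(3)[OF slack_hyps] card_high_less by linarith
  moreover have "card F \<le> t * card F" using t_pos by simp
  ultimately show "card F \<le> card high" using * by linarith
qed

text \<open>By the degree bound 2, the vertex sets of the paths of a minimal cover are closed under
  adjacency in \<open>B\<close>, hence in \<open>V - high\<close>. So toughness bounds the number of
  paths.\<close>

lemma separated_path_cover: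
  assumes C: "min_path_cover E B C" and B: "B \<subseteq> V - high"
    and deg2: "\<And>x. x \<in> B \<Longrightarrow> card (E `` {x} \<inter> B) \<le> 2"
    and cl: "\<And>x y. x \<in> B \<Longrightarrow> y \<in> V - high \<Longrightarrow> (x, y) \<in> E \<Longrightarrow> y \<in> B"
  shows "separated E (V - high) (set ` C)" "card (set ` C) = card C"
proof -
  have pc: "path_cover E B C" using C unfolding min_path_cover_def by simp
  have BV: "B \<subseteq> V" using B by auto
  show "separated E (V - high) (set ` C)"
    unfolding separated_def
  proof (intro conjI ballI impI)
    fix X assume "X \<in> set ` C"
    then obtain P where P: "P \<in> C" "X = set P" by blast
    have XB: "X \<subseteq> B" "X \<noteq> {}" using pc P unfolding path_cover_def by auto
    thus "X \<noteq> {}" "X \<subseteq> V - high" using B by auto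
    fix x y assume x: "x \<in> X" and y: "y \<in> V - high" "(x, y) \<in> E"
    have "y \<in> B" using cl[of x y] XB x y by blast
    thus "y \<in> X" using min_path_cover_degree2[OF C BV deg2 P(1), of x y] x y P(2) by blast
  next
    fix X Y assume "X \<in> set ` C" "Y \<in> set ` C" "X \<noteq> Y"
    thus "X \<inter> Y = {}" using pc unfolding path_cover_def by (elim imageE) metis
  qed
  have "inj_on set C" using pc unfolding path_cover_def inj_on_def by (metis Int_absorb set_empty)
  thus "card (set ` C) = card C" by (rule card_image)
qed

text \<open>Isolated vertices are parts of their own. Toughness treats two or more of them, the
  assumption on \<open>card high\<close> at most one.\<close>

lemma card_isolated:
  assumes B: "B \<subseteq> V - high" and t3: "t = 3" and k: "3 \<le> card high"
    and cl: "\<And>x y. x \<in> B \<Longrightarrow> y \<in> V - high \<Longrightarrow> (x, y) \<in> E \<Longrightarrow> y \<in> B"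
  shows "3 * card {x \<in> B. E `` {x} \<inter> B = {}} \<le> card high"
proof -
  let ?I = "{x \<in> B. E `` {x} \<inter> B = {}}"
  have sep: "separated E (V - high) ((\<lambda>x. {x}) ` ?I)"
    unfolding separated_def using B cl by auto
  have "card ((\<lambda>x. {x}) ` ?I) = card ?I" by (rule card_image) auto
  hence "2 \<le> card ?I \<Longrightarrow> 3 * card ?I \<le> card high" using separation(1)[OF sep] t3 by simp
  thus ?thesis using k by linarith
qed

text \<open>Either \<open>rest\<close> is a clique without edges to \<open>low\<close>, or all
  degrees in \<open>V - high\<close> are at most \<open>t\<close>. In both cases a minimal path
  cover turns out too small: for \<open>t \<le> 2\<close> by toughness applied to its paths, for
  \<open>t = 3\<close> by counting.\<close>

theorem contradiction: False
proof -
  let ?k = "card high"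
  have k: "1 \<le> ?k" "deg E u - ?k \<le> t"
    using slk_facts(3)[OF slack_hyps] card_high_less by linarith+
  have WV: "V - high = low \<union> rest" using partition high_disjoint by auto
  have deg_low: "card (E `` {x} \<inter> (V - high)) \<le> t" if "x \<in> low" for x
  proof -
    have "x \<in> V - high" using that WV by blast
    thus ?thesis using nbrs_outside_high[of x] low_deg[OF that] k(2) by linarith
  qed
  show False
  proof (cases "slk < int n - 1 - 2 * int (card low)")
    case True
    note rc = rest_clique[OF True]
    have cl_rest: "y \<in> rest" if "x \<in> rest" "y \<in> V - high" "(x, y) \<in> E" for x y
      using rc[OF that(1)] that by auto
    have cl_low: "y \<in> low" if "x \<in> low" "y \<in> V - high" "(x, y) \<in> E" for x y
      using cl_rest[of y x] that WV E_sym partition by auto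
    have low_sub: "low \<subseteq> V - high" "low \<subseteq> V" using WV unfolding low_def by auto
    obtain C where C: "min_path_cover E low C" using min_path_cover_exists finite_sets(1) by blast
    obtain p where p: "set p = rest" "distinct p" using finite_distinct_list finite_sets(3) by metis
    have "walk E p"
      unfolding successively_conv_nth
    proof (intro allI impI)
      fix i assume i: "Suc i < length p"
      hence "p ! i \<in> set p" "p ! Suc i \<in> set p" "p ! Suc i \<noteq> p ! i"
        using p(2) by (simp_all add: nth_eq_iff_index_eq)
      thus "(p ! i, p ! Suc i) \<in> E" using rc[of "p ! i"] unfolding p(1) by blast
    qed
    hence "path_cover E rest {p}" using p v_rest unfolding path_cover_def by auto
    hence "path_cover E (V - high) (C \<union> {p})"
      unfolding WV using C partition(2) path_cover_Un unfolding min_path_cover_def by blast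
    \<comment> \<open>The clique \<open>rest\<close> takes one path, so \<open>low\<close> alone
      takes at least \<open>card high\<close> paths.\<close>
    from path_cover_large[OF this] have large: "?k \<le> card C"
      using card_insert_le_m1[of "card C + 1" C p] by (simp add: card_insert_if split: if_splits)
    have deg_low': "card (E `` {x} \<inter> low) \<le> t" if "x \<in> low" for x
    proof -
      have "card (E `` {x} \<inter> low) \<le> card (E `` {x} \<inter> (V - high))"
        using low_sub by (intro card_mono) auto
      thus ?thesis using deg_low[OF that] by simp
    qed
    show False
    proof (cases "t = 3")
      case False
      hence t2: "t \<le> 2" using tn by auto
      have d2: "card (E `` {x} \<inter> low) \<le> 2" if "x \<in> low" for x
        using deg_low'[OF that] t2 by simp
      note sp = separated_path_cover[OF C low_sub(1) d2 cl_low]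
      have disj: "rest \<inter> set P = {}" if "P \<in> C" for P
        using that C partition(2) unfolding min_path_cover_def path_cover_def by blast
      have "rest \<noteq> {}" "rest \<subseteq> V - high" using v_rest WV by auto
      hence "separated E (V - high) (insert rest (set ` C))"
        using disj by (intro separated_insert[OF sp(1) _ _ _ cl_rest]) auto
      moreover have "card (insert rest (set ` C)) = card C + 1"
      proof -
        have "rest \<notin> set ` C" using disj v_rest by blast
        moreover have "finite C" using C unfolding min_path_cover_def path_cover_def by blast
        ultimately show ?thesis using sp(2) by simp
      qed
      ultimately have "card C + 1 \<le> ?k" using separation(2)[of "insert rest (set ` C)"] by simp
      thus False using large by simp
    next
      case t3: True
      have f5: "int (card low) - 3 \<le> int ?k" "11 \<le> ?k \<or> ?k < 6"
        using slk_facts(5)[OF slack_hyps] card_high_less t3 by auto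
      \<comment> \<open>The two parts \<open>low\<close> and \<open>rest\<close> force
        \<open>card high\<close> to be at least 6, which leaves only the alternative
        \<open>11 \<le> ?k\<close>.\<close>
      have "separated E (V - high) {low, rest}"
      proof (intro separated_insert separated_empty)
        show "low \<noteq> {}" using u_le_card_low min_deg[OF u] t_pos by auto
        show "low \<inter> X = {}" if "X \<in> {rest}" for X using that partition(2) by simp
      qed (use WV v_rest cl_low cl_rest in blast)+
      moreover have "card {low, rest} = 2" using v_rest partition(2) by (auto simp: card_insert_if)
      ultimately have "6 \<le> ?k" using separation(1)[of "{low, rest}"] t3 by simp
      hence k11: "11 \<le> ?k" using f5 by simp
      have "2 * card C \<le> card low + card {x \<in> low. E `` {x} \<inter> low = {}}"
        using min_path_cover_degree3[OF C low_sub(2)] deg_low' t3 by simp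
      moreover have "3 * card {x \<in> low. E `` {x} \<inter> low = {}} \<le> ?k"
        using card_isolated[OF low_sub(1) t3 _ cl_low] k11 by simp
      \<comment> \<open>With \<open>k = card high\<close> the bounds give
        \<open>2 * k \<le> (k + 3) + k / 3\<close>, hence \<open>k \<le> 4\<close>.\<close>
      ultimately show False using large f5(1) k11 path_cover_large by linarith
    qed
  next
    case False
    hence jk: "deg E v - ?k \<le> t"
      using slk_facts(4)[OF slack_hyps] card_high_less card_low n_large by linarith
    have dW: "card (E `` {x} \<inter> (V - high)) \<le> t" if "x \<in> V - high" for x
    proof (cases "x \<in> low")
      case F: False
      hence "deg E x \<le> deg E v" using rest_deg that WV by blast
      thus ?thesis using nbrs_outside_high[OF that] jk by linarith
    qed (rule deg_low)
    obtain C where C: "min_path_cover E (V - high) C"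
      using min_path_cover_exists[OF finite_Diff[OF finite_V]] by blast
    have large: "?k < card C" by (rule path_cover_large) (use C in \<open>simp add: min_path_cover_def\<close>)
    show False
    proof (cases "t = 3")
      case F: False
      hence t2: "t \<le> 2" using tn by auto
      have d2: "card (E `` {x} \<inter> (V - high)) \<le> 2" if "x \<in> V - high" for x
        using dW[OF that] t2 by simp
      note sp = separated_path_cover[OF C order_refl d2]
      have "card C \<le> ?k" using separation(2)[OF sp(1)] sp(2) by simp
      thus False using large by simp
    next
      case t3: True
      have f5: "int (card low) - 3 \<le> int ?k" "11 \<le> ?k"
        using slk_facts(5)[OF slack_hyps] card_high_less t3 False by auto
      have "2 * card C \<le> card (V - high) + card {x \<in> V - high. E `` {x} \<inter> (V - high) = {}}"
        using min_path_cover_degree3[OF C _] dW t3 by simp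
      moreover have "3 * card {x \<in> V - high. E `` {x} \<inter> (V - high) = {}} \<le> ?k"
        using card_isolated[OF order_refl t3] f5 by simp
      moreover have "card (V - high) = card low + card rest"
        unfolding WV using partition(2) by (simp add: card_Un_disjoint)
      \<comment> \<open>Here \<open>rest\<close> has at most \<open>t + 1 = 4\<close> vertices, so
        \<open>2 * (k + 1) \<le> (k + 3) + 4 + k / 3\<close> for \<open>k = card high\<close>, which
        fails from 11 on.\<close>
      ultimately show False using large f5 jk t3 card_partition card_low by linarith
    qed
  qed
qed

end

theorem (in sgraph) hamiltonian_if_separation_bound:
  assumes tn: "t = 1 \<and> 7 \<le> card V \<or> t = 2 \<and> 16 \<le> card V \<or> t = 3 \<and> 28 \<le> card V"
    and tough: "separation_bound t V E"
    and size: "(int (card V) - 2 * int t) * (int (card V) - 2 * int t - 1) + 6 * (int t)^2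
      \<le> (\<Sum>x\<in>V. int (deg E x))"
  shows "hamiltonian V E"
proof (rule ccontr)
  assume nh: "\<not> hamiltonian V E"
  have V3: "3 \<le> card V" using tn by auto
  obtain F where F: "E \<subseteq> F" "sgraph V F" "\<not> hamiltonian V F"
    and ore: "\<And>u v. u \<in> V \<Longrightarrow> v \<in> V \<Longrightarrow> u \<noteq> v \<Longrightarrow> (u, v) \<notin> F \<Longrightarrow> deg F u + deg F v \<le> card V - 1"
    using saturated_supergraph[OF V3 nh] by blast
  interpret F: sgraph V F by (rule F(2))
  define N where "N = {(x, y). x \<in> V \<and> y \<in> V \<and> x \<noteq> y \<and> (x, y) \<notin> F}"
  \<comment> \<open>As degrees are less than \<open>card V\<close>, this number orders pairs
    lexicographically by degree sum, then by the degree of the second vertex.\<close>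
  define rank where "rank = (\<lambda>(x, y). card V * (deg F x + deg F y) + deg F y)"
  \<comment> \<open>A complete graph is Hamiltonian: take all of \<open>V\<close> as universal
    vertices and cover the empty remainder by no paths.\<close>
  have "N \<noteq> {}"
  proof
    assume "N = {}"
    hence "path_cover F (V - V) {}" "\<And>s y. s \<in> V \<Longrightarrow> y \<in> V \<Longrightarrow> y \<noteq> s \<Longrightarrow> (s, y) \<in> F \<and> (y, s) \<in> F"
      unfolding N_def path_cover_def by auto
    moreover have "V \<noteq> {}" using V3 by auto
    ultimately have "hamiltonian V F" using hamiltonian_if_path_cover[OF finite_V _ order_refl] V3 by auto
    thus False using F by simp
  qed
  moreover have "finite N"
    by (rule finite_subset[of _ "V \<times> V"]) (use finite_V in \<open>auto simp: N_def\<close>)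
  ultimately obtain p where p: "p \<in> N" "\<And>q. q \<in> N \<Longrightarrow> rank q \<le> rank p"
  proof -
    assume that: "\<And>p. p \<in> N \<Longrightarrow> (\<And>q. q \<in> N \<Longrightarrow> rank q \<le> rank p) \<Longrightarrow> thesis"
    assume N: "N \<noteq> {}" "finite N"
    hence "Max (rank ` N) \<in> rank ` N" by simp
    then obtain p where "p \<in> N" "rank p = Max (rank ` N)" by auto
    thus thesis using that[of p] N by simp
  qed
  obtain u v where uv: "p = (u, v)" by (cases p)
  have u: "u \<in> V" "v \<in> V" "u \<noteq> v" "(u, v) \<notin> F" using p uv unfolding N_def by auto
  have rank: "card V * (deg F x + deg F y) + deg F y \<le> card V * (deg F u + deg F v) + deg F v"
    if "x \<in> V" "y \<in> V" "x \<noteq> y" "(x, y) \<notin> F" for x y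
    using p(2)[of "(x, y)"] that uv unfolding N_def rank_def by simp
  have small: "deg F v < card V" using F.deg_le[OF u(2)] V3 by simp
  have "extremal_pair V F t (card V) u v"
  proof unfold_locales
    fix x y assume xy: "x \<in> V" "y \<in> V" "x \<noteq> y" "(x, y) \<notin> F"
    show sum: "deg F x + deg F y \<le> deg F u + deg F v"
    proof (rule ccontr)
      assume "\<not> ?thesis"
      hence "card V * (deg F u + deg F v + 1) \<le> card V * (deg F x + deg F y)" by (intro mult_left_mono) auto
      thus False using rank[OF xy] small by (simp add: algebra_simps)
    qed
    show "deg F y \<le> deg F v" if "deg F x + deg F y = deg F u + deg F v"
      using rank[OF xy] that by simp
  next
    have "(\<Sum>x\<in>V. int (deg E x)) \<le> (\<Sum>x\<in>V. int (deg F x))"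
      unfolding deg_def using F(1) by (intro sum_mono) (auto intro!: card_mono)
    thus "(int (card V) - 2 * int t) * (int (card V) - 2 * int t - 1) + 6 * (int t)^2
      \<le> (\<Sum>x\<in>V. int (deg F x))" using size by linarith
  qed (use u ore F tn separation_bound_mono[OF tough F(1)] in auto)
  thus False by (rule extremal_pair.contradiction)
qed

section \<open>Graphs as symmetric digraphs\<close>

lemma sgraph_pair_graph:
  assumes "pair_graph G"
  shows "sgraph (pverts G) (parcs G)"
proof -
  interpret pair_graph G by fact
  show ?thesis
  proof
    show "finite (pverts G)" by (rule pair_finite_verts)
    show "parcs G \<subseteq> pverts G \<times> pverts G" using in_arcsD1 in_arcsD2 by auto
    show "sym (parcs G)" using pair_sym_arcs unfolding symmetric_def by simp
    show "irrefl (parcs G)" using pair_no_loops unfolding irrefl_def by fastforce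
  qed
qed

lemma out_degree_eq_deg: "out_degree (with_proj G) x = deg (parcs G) x"
proof -
  have "out_arcs (with_proj G) x = Pair x ` (parcs G `` {x})"
    unfolding out_arcs_def by auto
  moreover have "inj_on (Pair x) (parcs G `` {x})" by (auto simp: inj_on_def)
  ultimately show ?thesis unfolding out_degree_def deg_def by (simp add: card_image)
qed

section \<open>Cycles and components in symmetric digraphs\<close>

lemma pcas_zip: "pcas x (zip (x # xs) (xs @ [y])) y"
  by (induction xs arbitrary: x) auto

lemma pawalk_verts_zip: "pawalk_verts u (zip (x # xs) (xs @ [y])) = x # xs @ [y]"
  by (induction xs arbitrary: u x) auto

text \<open>Library cycles are lists of arcs; pairing the vertex list with its rotation by one
  produces them.\<close>

lemma cycle_of_cyclic_list:
  assumes G: "pair_graph G" and c: "cyclic_list (parcs G) c"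
  shows "\<exists>p. pre_digraph.cycle (with_proj G) p \<and> length p = length c"
proof -
  interpret pair_graph G by fact
  obtain x xs where xs: "c = x # xs" using c unfolding cyclic_list_def by (cases c) auto
  let ?p = "zip (x # xs) (xs @ [x])"
  have len: "length ?p = length c" using xs by simp
  have "set ?p \<subseteq> parcs G"
  proof
    fix e assume "e \<in> set ?p"
    then obtain i where i: "i < length c" "e = (c ! i, (xs @ [x]) ! i)"
      using xs by (auto simp: in_set_zip)
    moreover have "(xs @ [x]) ! i = c ! (Suc i mod length c)"
    proof (cases "Suc i = length c")
      case True thus ?thesis using xs by (simp add: nth_append)
    next
      case False thus ?thesis using xs i(1) by (simp add: nth_append)
    qed
    ultimately show "e \<in> parcs G" using c unfolding cyclic_list_def by simp
  qed
  moreover have "x \<in> pverts G"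
  proof -
    have "(x, c ! (Suc 0 mod length c)) \<in> parcs G"
      using c xs unfolding cyclic_list_def by fastforce
    thus ?thesis by (rule in_arcsD1)
  qed
  moreover have "distinct (tl (pawalk_verts x ?p))"
    using c xs unfolding pawalk_verts_zip cyclic_list_def by auto
  moreover have "?p \<noteq> []" by (cases xs) auto
  ultimately have "cycle ?p" unfolding cycle_def awalk_def
    using pcas_zip[of x xs x] by (intro exI[of _ x]) simp
  thus ?thesis using len by blast
qed

lemma pancyclic_if_cyclic_lists:
  assumes "pair_graph G"
    and "\<And>l. 3 \<le> l \<Longrightarrow> l \<le> card (pverts G) \<Longrightarrow> \<exists>c. cyclic_list (parcs G) c \<and> length c = l"
  shows "pancyclic G"
  unfolding pancyclic_def using assms cycle_of_cyclic_list by metis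

text \<open>The strong component of a representative stays inside its member of \<open>F\<close>, so
  different members yield different components.\<close>

lemma card_separated_le_num_components:
  assumes G: "pair_graph G" and F: "separated (parcs G) (pverts G - S) F"
  shows "card F \<le> num_components (delete_verts G S)"
proof -
  interpret G: pair_graph G by fact
  let ?W = "pverts G - S" and ?H = "delete_verts G S"
  interpret H: wf_digraph ?H
    unfolding delete_verts_def by (rule G.wellformed_induce_subgraph)
  have vH: "verts ?H = ?W" unfolding delete_verts_def by simp
  have aH: "(x, y) \<in> parcs G \<and> x \<in> ?W \<and> y \<in> ?W" if "x \<rightarrow>\<^bsub>?H\<^esub> y" for x y
    using that unfolding delete_verts_def by (auto simp: arcs_ends_conv)
  have reach: "y \<in> X" if X: "X \<in> F" "x \<in> X" and r: "x \<rightarrow>\<^sup>*\<^bsub>?H\<^esub> y" for X x y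
    using r X(2)
  proof (induction rule: H.reachable_induct)
    case (step y z)
    thus ?case using F X(1) aH[of y z] unfolding separated_def by blast
  qed
  have ne: "X \<noteq> {}" "X \<subseteq> ?W" if "X \<in> F" for X
    using F that unfolding separated_def by simp_all
  have disj: "X \<inter> Y = {}" if "X \<in> F" "Y \<in> F" "X \<noteq> Y" for X Y
    using F that unfolding separated_def by simp
  define r where "r = (\<lambda>X :: 'a set. SOME x. x \<in> X)"
  have r: "r X \<in> X" "r X \<in> ?W" if "X \<in> F" for X
    using ne[OF that] some_in_eq[of X] unfolding r_def by auto
  have sub: "H.scc_of (r X) \<subseteq> X" if "X \<in> F" for X
    using reach[OF that r(1)[OF that]] unfolding H.scc_of_def by blast
  have mem: "r X \<in> H.scc_of (r X)" if "X \<in> F" for X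
    by (rule H.in_scc_of_self) (use r(2)[OF that] vH in simp)
  have "inj_on (\<lambda>X. H.scc_of (r X)) F"
  proof (rule inj_onI, rule ccontr)
    fix X Y assume XY: "X \<in> F" "Y \<in> F" "H.scc_of (r X) = H.scc_of (r Y)" "X \<noteq> Y"
    hence "r X \<in> X \<inter> Y" using mem[OF XY(1)] sub[OF XY(2)] r(1)[OF XY(1)] by auto
    thus False using disj XY by blast
  qed
  moreover have "(\<lambda>X. H.scc_of (r X)) ` F \<subseteq> H.sccs_verts"
    using r(2) vH H.scc_of_in_sccs_verts by (intro image_subsetI) simp
  moreover have "finite H.sccs_verts"
  proof -
    have "H.scc_of x \<subseteq> ?W" for x
      using H.reachable_in_verts(2) vH unfolding H.scc_of_def by blast
    hence "H.sccs_verts \<subseteq> Pow ?W" unfolding H.sccs_verts_conv_scc_of by blast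
    thus ?thesis using G.pair_finite_verts by (meson finite_Diff finite_Pow_iff finite_subset)
  qed
  ultimately have "card F \<le> card H.sccs_verts" by (meson card_inj_on_le)
  thus ?thesis unfolding num_components_def H.card_sccs_verts .
qed

lemma separation_bound_if_tough:
  assumes G: "pair_graph G" and tough: "tough (real t) G"
  shows "separation_bound t (pverts G) (parcs G)"
  unfolding separation_bound_def
proof (intro allI impI, elim conjE)
  fix S F assume S: "S \<subseteq> pverts G" and F: "separated (parcs G) (pverts G - S) F" "2 \<le> card F"
  note c = card_separated_le_num_components[OF G F(1)]
  hence "vertex_cutset G S" using S F(2) unfolding vertex_cutset_def by simp
  hence "real t * real (num_components (delete_verts G S)) \<le> real (card S)"
    using tough unfolding tough_def by blast
  moreover have "real t * real (card F) \<le> real t * real (num_components (delete_verts G S))"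
    using c by (intro mult_left_mono) auto
  ultimately have "real (t * card F) \<le> real (card S)" by simp
  thus "t * card F \<le> card S" by (simp only: of_nat_le_iff)
qed

lemma deg_pos_if_connected:
  assumes G: "pair_graph G" and conn: "Digraph_Component.connected (with_proj G)"
    and V2: "2 \<le> card (pverts G)" and x: "x \<in> pverts G"
  shows "1 \<le> deg (parcs G) x"
proof -
  interpret G: pair_graph G by fact
  interpret S: sgraph "pverts G" "parcs G" by (rule sgraph_pair_graph[OF G])
  have "\<not> pverts G \<subseteq> {x}" using V2 card_mono[of "{x}" "pverts G"] by auto
  then obtain y where y: "y \<in> pverts G" "y \<noteq> x" by blast
  have "strongly_connected (with_proj G)"
    using G.symmetric_connected_imp_strongly_connected[OF G.pair_sym_arcs conn] .
  hence "x \<rightarrow>\<^sup>*\<^bsub>with_proj G\<^esub> y" using x y unfolding strongly_connected_def by simp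
  then obtain w where "(x, w) \<in> parcs G"
    using y by (cases rule: G.converse_reachable_cases) auto
  hence "parcs G `` {x} \<noteq> {}" by blast
  thus ?thesis unfolding deg_def using S.finite_nbrs by (metis One_nat_def Suc_leI card_gt_0_iff)
qed

section \<open>The signless Laplacian\<close>

text \<open>Makes the maximum of the spectrum meaningful. For a complex eigenvalue \<open>c\<close>
  with eigenvector \<open>z\<close>, the Hermitian form of \<open>A\<close> at \<open>z\<close> is
  \<open>c\<close> times the squared norm, and symmetry makes it real.\<close>

lemma real_symmetric_has_eigenvalue:
  fixes A :: "real mat"
  assumes A: "A \<in> carrier_mat n n" and n: "0 < n"
    and sym: "\<And>i j. i < n \<Longrightarrow> j < n \<Longrightarrow> A $$ (i, j) = A $$ (j, i)"
  shows "spectrum A \<noteq> {}"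
proof -
  let ?B = "map_mat complex_of_real A"
  have B: "?B \<in> carrier_mat n n" using A by simp
  obtain c where c: "c \<in> spectrum ?B" using spectrum_non_empty[OF B n] by blast
  then obtain z where z: "z \<in> carrier_vec n" "z \<noteq> 0\<^sub>v n" "?B *\<^sub>v z = c \<cdot>\<^sub>v z"
    using B unfolding spectrum_def eigenvalue_def eigenvector_def by auto
  have Bz: "(\<Sum>j<n. complex_of_real (A $$ (i, j)) * z $ j) = c * z $ i" if i: "i < n" for i
  proof -
    have "(?B *\<^sub>v z) $ i = (\<Sum>j<n. complex_of_real (A $$ (i, j)) * z $ j)"
      using A z(1) i by (simp add: scalar_prod_def lessThan_atLeast0)
    thus ?thesis using z i by simp
  qed
  define q where "q = (\<Sum>i<n. \<Sum>j<n. cnj (z $ i) * complex_of_real (A $$ (i, j)) * z $ j)"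
  define r where "r = (\<Sum>i<n. (cmod (z $ i))\<^sup>2)"
  have "q = (\<Sum>i<n. cnj (z $ i) * (\<Sum>j<n. complex_of_real (A $$ (i, j)) * z $ j))"
    unfolding q_def by (simp add: sum_distrib_left mult.assoc)
  also have "\<dots> = (\<Sum>i<n. cnj (z $ i) * (c * z $ i))" by (rule sum.cong) (simp_all add: Bz)
  also have "\<dots> = c * complex_of_real r"
    unfolding r_def by (simp add: sum_distrib_left complex_norm_square mult_ac del: of_real_power)
  finally have q: "q = c * complex_of_real r" .
  have "cnj q = (\<Sum>i<n. \<Sum>j<n. z $ i * complex_of_real (A $$ (i, j)) * cnj (z $ j))"
    unfolding q_def by simp
  also have "\<dots> = (\<Sum>j<n. \<Sum>i<n. z $ i * complex_of_real (A $$ (i, j)) * cnj (z $ j))"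
    by (rule sum.swap)
  also have "\<dots> = q" unfolding q_def
    by (intro sum.cong refl) (simp add: sym mult_ac)
  finally have "cnj (c * complex_of_real r) = c * complex_of_real r" unfolding q .
  hence "cnj c * complex_of_real r = c * complex_of_real r" by simp
  moreover have "r \<noteq> 0"
  proof
    assume "r = 0"
    hence "\<forall>i \<in> {..<n}. (cmod (z $ i))\<^sup>2 = 0"
      unfolding r_def by (subst (asm) sum_nonneg_eq_0_iff) auto
    hence "z = 0\<^sub>v n" using z(1) by (intro eq_vecI) auto
    thus False using z(2) by simp
  qed
  ultimately have "cnj c = c" by simp
  then obtain a where a: "c = complex_of_real a"
    by (metis complex_eq_iff Im_complex_of_real Re_complex_of_real complex_cnj_cancel_iff Reals_cnj_iff Reals_cases)
  \<comment> \<open>The complexified matrix has the same characteristic polynomial, so the real root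
    is an eigenvalue of \<open>A\<close> itself.\<close>
  have "poly (char_poly ?B) c = 0" using c spectrum_root_char_poly[OF B] by simp
  moreover have "char_poly ?B = map_poly complex_of_real (char_poly A)"
    by (rule of_real_hom.char_poly_hom[OF A])
  ultimately have "complex_of_real (poly (char_poly A) a) = 0"
    unfolding a by simp
  hence "poly (char_poly A) a = 0" by simp
  hence "a \<in> spectrum A" using spectrum_root_char_poly[OF A] by simp
  thus ?thesis by blast
qed

text \<open>Scaling the eigenvector by the degrees turns \<open>Q\<close> into \<open>D\<^sup>-\<^sup>1 Q D\<close>, whose row sums are
  \<open>d(v) + (\<Sum>w\<sim>v. d(w)) / d(v)\<close>. The product form avoids the division.\<close>

lemma signless_laplacian_eigenvalue_le:
  fixes G :: "'a pair_pre_digraph"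
  assumes G: "pair_graph G"
    and vs: "distinct vs" "set vs = pverts G"
    and deg_pos: "\<And>x. x \<in> pverts G \<Longrightarrow> 1 \<le> deg (parcs G) x"
    and ev: "eigenvalue (signless_laplacian G vs) k"
  shows "\<exists>x \<in> pverts G. k * real (deg (parcs G) x) \<le>
    (real (deg (parcs G) x))\<^sup>2 + (\<Sum>y\<in>parcs G `` {x}. real (deg (parcs G) y))"
proof -
  define E where E: "E = parcs G"
  note pos = deg_pos[folded E]
  interpret sgraph "pverts G" E unfolding E by (rule sgraph_pair_graph[OF G])
  let ?n = "length vs" and ?Q = "signless_laplacian G vs"
  define d where "d = (\<lambda>i. real (deg E (vs ! i)))"
  have inV: "vs ! i \<in> pverts G" if "i < ?n" for i using vs that by (metis nth_mem)
  have dpos: "0 < d i" if "i < ?n" for i using pos[OF inV[OF that]] unfolding d_def by simp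
  have Q: "?Q \<in> carrier_mat ?n ?n"
    unfolding signless_laplacian_def degree_mat_def adjacency_mat_def by simp
  have Q_entry: "?Q $$ (i, j) = (if i = j then d i else 0) + (if (vs ! i, vs ! j) \<in> E then 1 else 0)"
    if "i < ?n" "j < ?n" for i j
    using that out_degree_eq_deg[of G] E unfolding signless_laplacian_def degree_mat_def adjacency_mat_def d_def by simp
  from ev obtain x where x: "x \<in> carrier_vec ?n" "x \<noteq> 0\<^sub>v ?n" "?Q *\<^sub>v x = k \<cdot>\<^sub>v x"
    using Q unfolding eigenvalue_def eigenvector_def by auto
  have row: "d i * x $ i + (\<Sum>j | j < ?n \<and> (vs ! i, vs ! j) \<in> E. x $ j) = k * x $ i" if i: "i < ?n" for i
  proof -
    have "k * x $ i = (?Q *\<^sub>v x) $ i" using x i by simp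
    also have "\<dots> = (\<Sum>j<?n. ?Q $$ (i, j) * x $ j)"
      using Q x(1) i by (simp add: scalar_prod_def lessThan_atLeast0)
    also have "\<dots> = (\<Sum>j<?n. (if i = j then d i * x $ j else 0) + (if (vs ! i, vs ! j) \<in> E then x $ j else 0))"
      using i by (intro sum.cong refl) (simp add: Q_entry distrib_right)
    also have "\<dots> = d i * x $ i + (\<Sum>j<?n. if (vs ! i, vs ! j) \<in> E then x $ j else 0)"
      using i by (simp add: sum.distrib)
    also have "(\<Sum>j<?n. if (vs ! i, vs ! j) \<in> E then x $ j else 0) = (\<Sum>j | j < ?n \<and> (vs ! i, vs ! j) \<in> E. x $ j)"
      by (simp add: sum.If_cases Int_def)
    finally show ?thesis by simp
  qed
  define y where "y = (\<lambda>i. \<bar>x $ i\<bar> / d i)"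
  obtain l where l: "l < ?n" "x $ l \<noteq> 0"
    using x(1,2) by (metis carrier_vecD eq_vecI index_zero_vec(1) index_zero_vec(2))
  have "Max (y ` {..<?n}) \<in> y ` {..<?n}" using l(1) by (intro Max_in) auto
  then obtain i where i: "i < ?n" "y i = Max (y ` {..<?n})" by auto
  have y_max: "y j \<le> y i" if "j < ?n" for j using i(2) that by simp
  have "0 < y l" unfolding y_def using l dpos by simp
  hence ypos: "0 < y i" using y_max[OF l(1)] by linarith
  have abs_x: "\<bar>x $ j\<bar> = y j * d j" if "j < ?n" for j
    unfolding y_def using dpos[OF that] by simp
  let ?N = "{j. j < ?n \<and> (vs ! i, vs ! j) \<in> E}"
  \<comment> \<open>Row \<open>i\<close> is read where the scaled entry is largest; absolute values
    cover both signs of \<open>k - d i\<close> and of \<open>x $ i\<close>.\<close>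
  have "(k - d i) * (y i * d i) \<le> \<bar>(k - d i) * x $ i\<bar>"
    using abs_x[OF i(1)] ypos dpos[OF i(1)] unfolding abs_mult by (metis abs_ge_self abs_ge_zero mult_right_mono)
  also have "(k - d i) * x $ i = (\<Sum>j\<in>?N. x $ j)" using row[OF i(1)] by (simp add: algebra_simps)
  also have "\<bar>\<dots>\<bar> \<le> (\<Sum>j\<in>?N. \<bar>x $ j\<bar>)" by (rule sum_abs)
  also have "\<dots> \<le> (\<Sum>j\<in>?N. y i * d j)"
    using abs_x y_max dpos by (intro sum_mono) (auto intro!: mult_right_mono less_imp_le)
  also have "\<dots> = y i * (\<Sum>j\<in>?N. d j)" by (simp add: sum_distrib_left)
  also have "(\<Sum>j\<in>?N. d j) = (\<Sum>w\<in>E `` {vs ! i}. real (deg E w))"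
  proof -
    have "(!) vs ` ?N = E `` {vs ! i}"
      using nbrs_subset[of "vs ! i"] vs(2) by (auto simp: in_set_conv_nth image_iff subset_iff) (metis in_set_conv_nth)
    moreover have "inj_on ((!) vs) ?N" using vs(1) by (auto simp: inj_on_def nth_eq_iff_index_eq)
    ultimately show ?thesis unfolding d_def by (metis (no_types, lifting) sum.cong sum.reindex_cong)
  qed
  finally have "y i * ((k - d i) * d i) \<le> y i * (\<Sum>w\<in>E `` {vs ! i}. real (deg E w))"
    by (simp add: mult_ac)
  hence "(k - d i) * d i \<le> (\<Sum>w\<in>E `` {vs ! i}. real (deg E w))" using ypos by simp
  hence "k * d i \<le> (d i)\<^sup>2 + (\<Sum>w\<in>E `` {vs ! i}. real (deg E w))"
    by (simp add: algebra_simps power2_eq_square)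
  thus ?thesis using inV[OF i(1)] unfolding d_def E by blast
qed

text \<open>With \<open>d = deg E x\<close> and \<open>N = card V - 1\<close>, the degree sum
  \<open>s\<close> over the neighbours of \<open>x\<close> is at most \<open>d * N\<close>. It is
  also at most \<open>D - N\<close>, since \<open>x\<close> contributes \<open>d\<close> to the
  total \<open>D\<close> and its \<open>N - d\<close> non-neighbours at least one each.\<close>

lemma (in sgraph) deg_plus_average_le:
  assumes x: "x \<in> V" and V2: "2 \<le> card V" and pos: "\<And>y. y \<in> V \<Longrightarrow> 1 \<le> deg E y"
    and k: "k * real (deg E x) \<le> (real (deg E x))\<^sup>2 + (\<Sum>y\<in>E `` {x}. real (deg E y))"
  shows "k \<le> (\<Sum>y\<in>V. real (deg E y)) / (real (card V) - 1) + real (card V) - 2"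
proof -
  define N where "N = real (card V) - 1"
  define d where "d = real (deg E x)"
  define s where "s = (\<Sum>y\<in>E `` {x}. real (deg E y))"
  define D where "D = (\<Sum>y\<in>V. real (deg E y))"
  have d: "1 \<le> d" "d \<le> N" using pos[OF x] deg_le[OF x] V2 unfolding d_def N_def by linarith+
  have N: "1 \<le> N" using V2 unfolding N_def by simp
  have "s \<le> (\<Sum>y\<in>E `` {x}. N)"
    unfolding s_def N_def using deg_le nbrs_subset V2 by (intro sum_mono) fastforce
  hence s1: "s \<le> d * N" unfolding d_def deg_def by simp
  let ?R = "V - {x} - E `` {x}"
  have "insert x (E `` {x}) \<subseteq> V" using x nbrs_subset by blast
  from sum.subset_diff[OF this finite_V, of "\<lambda>y. real (deg E y)"]
  have "D = (\<Sum>y\<in>V - insert x (E `` {x}). real (deg E y)) + (d + s)"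
    unfolding D_def d_def s_def using no_loop by simp
  moreover have "V - insert x (E `` {x}) = ?R" by blast
  ultimately have "D = (\<Sum>y\<in>?R. real (deg E y)) + (d + s)" by simp
  moreover have "(\<Sum>y\<in>?R. 1) \<le> (\<Sum>y\<in>?R. real (deg E y))"
  proof (intro sum_mono)
    fix y assume "y \<in> ?R"
    hence "1 \<le> deg E y" using pos by blast
    thus "1 \<le> real (deg E y)" by simp
  qed
  moreover have "real (card ?R) = N - d"
    using deg_add_nonnbrs[OF x] V2 unfolding N_def d_def by linarith
  ultimately have s2: "s \<le> D - N" by simp
  \<comment> \<open>The weights \<open>d\<close> and \<open>N - d\<close> combine the two estimates
    so that the factor \<open>d\<close> can be cancelled afterwards.\<close>
  have "N * s = d * s + (N - d) * s" by (simp add: algebra_simps)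
  also have "\<dots> \<le> d * (D - N) + (N - d) * (d * N)"
    using s1 s2 d by (intro add_mono mult_left_mono) auto
  finally have "N * (d\<^sup>2 + s) \<le> d * (D + N * (N - 1))"
    by (simp add: algebra_simps power2_eq_square)
  moreover have "N * (k * d) \<le> N * (d\<^sup>2 + s)" using k N unfolding d_def s_def by (intro mult_left_mono) auto
  ultimately have "d * (N * k) \<le> d * (D + N * (N - 1))" by (simp add: mult_ac)
  hence "N * k \<le> D + N * (N - 1)" using d by simp
  hence "k \<le> (D + N * (N - 1)) / N" using N by (simp add: pos_le_divide_eq mult_ac)
  also have "\<dots> = D / N + real (card V) - 2" using N by (simp add: add_divide_distrib N_def)
  finally show ?thesis unfolding D_def N_def .
qed

section \<open>From the spectral bound to pancyclicity\<close>

theorem theorem2p3: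
  fixes G :: "'a pair_pre_digraph" and vs :: "'a list" and t n m :: nat
  assumes "t \<in> {1, 2, 3}"
    and "pair_graph G"
    and "Digraph_Component.connected (with_proj G)"
    and "tough (real t) G"
    and "n = card (pverts G)"
    and "m = card (edges G)"
    and "distinct vs" and "set vs = pverts G"
    and "largest_eigenvalue (signless_laplacian G vs) \<ge>
      ((real n)^2 + 10 * (real t)^2 - 4 * real t * real n + 2 * real t - real n) / (real n - 1)
        + real n - 2"
    and "t = 1 \<and> n \<ge> 7 \<or> t = 2 \<and> n \<ge> 16 \<or> t = 3 \<and> n \<ge> 28"
  shows "pancyclic G \<or> bipartite G"
proof -
  let ?V = "pverts G" and ?E = "parcs G" and ?Q = "signless_laplacian G vs"
  interpret sgraph ?V ?E by (rule sgraph_pair_graph[OF assms(2)])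
  have tn: "t = 1 \<and> 7 \<le> card ?V \<or> t = 2 \<and> 16 \<le> card ?V \<or> t = 3 \<and> 28 \<le> card ?V"
    using assms(5,10) by auto
  hence V2: "2 \<le> card ?V" by auto
  have pos: "1 \<le> deg ?E x" if "x \<in> ?V" for x
    using deg_pos_if_connected[OF assms(2,3) V2 that] .
  have len: "length vs = n" using assms(5,7,8) distinct_card by metis
  have Q: "?Q \<in> carrier_mat n n"
    unfolding signless_laplacian_def degree_mat_def adjacency_mat_def len by simp
  have "spectrum ?Q \<noteq> {}"
  proof (rule real_symmetric_has_eigenvalue[OF Q])
    show "0 < n" using V2 assms(5) by simp
    fix i j assume ij: "i < n" "j < n"
    show "?Q $$ (i, j) = ?Q $$ (j, i)"
      using ij E_sym[of "vs ! i" "vs ! j"] E_sym[of "vs ! j" "vs ! i"] len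
      unfolding signless_laplacian_def degree_mat_def adjacency_mat_def by auto
  qed
  with card_finite_spectrum(1)[OF Q] have "largest_eigenvalue ?Q \<in> spectrum ?Q"
    unfolding largest_eigenvalue_def by (rule Max_in)
  hence ev: "eigenvalue ?Q (largest_eigenvalue ?Q)" unfolding spectrum_def by simp
  obtain x where x: "x \<in> ?V" "largest_eigenvalue ?Q * real (deg ?E x) \<le>
      (real (deg ?E x))\<^sup>2 + (\<Sum>y\<in>?E `` {x}. real (deg ?E y))"
    using signless_laplacian_eigenvalue_le[OF assms(2,7,8) _ ev] pos by metis
  define D where "D = (\<Sum>y\<in>?V. real (deg ?E y))"
  have "largest_eigenvalue ?Q \<le> D / (real n - 1) + real n - 2"
    unfolding D_def assms(5) by (rule deg_plus_average_le[OF x(1) V2 pos x(2)])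
  with assms(9) have "((real n)\<^sup>2 + 10 * (real t)\<^sup>2 - 4 * real t * real n + 2 * real t - real n) / (real n - 1)
      \<le> D / (real n - 1)" by linarith
  hence D: "(real n)\<^sup>2 + 10 * (real t)\<^sup>2 - 4 * real t * real n + 2 * real t - real n \<le> D"
    using V2 assms(5) by (simp add: divide_le_cancel)
  let ?M = "(int n - 2 * int t) * (int n - 2 * int t - 1) + 6 * (int t)\<^sup>2"
  have "real_of_int ?M = (real n)\<^sup>2 + 10 * (real t)\<^sup>2 - 4 * real t * real n + 2 * real t - real n"
    by (simp add: algebra_simps power2_eq_square)
  with D have "real_of_int ?M \<le> real_of_int (\<Sum>y\<in>?V. int (deg ?E y))"
    unfolding D_def by simp
  hence size: "?M \<le> (\<Sum>y\<in>?V. int (deg ?E y))" by (simp only: of_int_le_iff)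
  have "hamiltonian ?V ?E"
    by (rule hamiltonian_if_separation_bound[OF tn separation_bound_if_tough[OF assms(2,4)]])
      (use size assms(5) in simp)
  moreover have "card ?V * card ?V < 2 * (\<Sum>y\<in>?V. deg ?E y)"
  proof -
    \<comment> \<open>The difference of the two sides is \<open>(n - 4) * (n - 6)\<close>,
      \<open>(n - 9)^2 + 7\<close> and \<open>(n - 13)^2 + 23\<close> for
      \<open>t = 1, 2, 3\<close>.\<close>
    have "int n * int n < 2 * ?M"
      using assms(10)
    proof (elim disjE conjE)
      assume t: "t = 1" and n: "7 \<le> n"
      have "0 < (int n - 4) * (int n - 6)" using n by (intro mult_pos_pos) auto
      thus ?thesis by (simp add: t algebra_simps power2_eq_square)
    next
      assume t: "t = 2"
      have "0 \<le> (int n - 9) * (int n - 9)" by simp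
      thus ?thesis by (simp add: t algebra_simps power2_eq_square)
    next
      assume t: "t = 3"
      have "0 \<le> (int n - 13) * (int n - 13)" by simp
      thus ?thesis by (simp add: t algebra_simps power2_eq_square)
    qed
    also have "\<dots> \<le> 2 * int (\<Sum>y\<in>?V. deg ?E y)" using size by simp
    finally have "int (n * n) < int (2 * (\<Sum>y\<in>?V. deg ?E y))" by simp
    thus ?thesis unfolding assms(5) by (simp only: of_nat_less_iff)
  qed
  ultimately have "pancyclic G"
    using cycle_lengths_if_hamiltonian by (intro pancyclic_if_cyclic_lists[OF assms(2)])
  thus ?thesis ..
qed

end
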